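(* Let $G=(V,E)$ be an infinite, locally finite, connected graph, and let $p_t(x,y)=\lim_{r\to\infty}p_t^r(x,y)$ be the limit of the Dirichlet heat kernels of the balls $B_r$ about a fixed vertex $x_0$. Then $p:V\times V\times[0,\infty)\to\mathbf{R}$ has the following properties: 1) $p_t(x,y)>0$ and $p_t(x,y)=p_t(y,x)$ for all $t>0$ and all $x,y\in V$. 2) $p$ is $C^\infty$ in $t$. 3) $\Delta p_t(x,y)+\frac{\partial}{\partial t}p_t(x,y)=0$, where $\Delta$ denotes the Laplacian in either $x$ or $y$. 4) $p_0(x,y)=\delta_x(y)$ for all $x,y\in V$. 5) $p_{s+t}(x,y)=\sum_{z\in V}p_s(x,z)p_t(z,y)$ for all $s,t\ge0$ and all $x,y\in V$. 6) $\sum_{y\in V}p_t(x,y)\le1$ for all $t\ge0$ and all $x\in V$. 7) $p$ is independent of the exhaustion used to define it: if $D_1\subset D_2\subset\cdots$ are finite, connected subgraphs with $G=\bigcup_i D_i$, then the Dirichlet heat kernels of the $D_i$ also converge to $p_t(x,y)$. 8) $p$ is the smallest non-negative function that satisfies properties 3) and 4).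
   Context: $\Delta f(x)=\sum_{y\sim x}(f(x)-f(y))$ is the combinatorial Laplacian, where $y\sim x$ means $x,y$ are joined by an edge of $G$; $\delta_x(y)=1$ if $x=y$ and $0$ otherwise. For a finite connected subgraph $D$, its boundary $\partial D$ is the set of vertices of $D$ having a neighbor in $G$ not in $D$, and $\operatorname{int}D$ is the set of remaining vertices of $D$. $C(D,\partial D)$ is the space of functions on the vertices of $D$ vanishing on $\partial D$, and the reduced Laplacian on it is $\Delta_Df(x)=\Delta f(x)$ for $x\in\operatorname{int}D$ and $\Delta_Df(x)=0$ otherwise; it is self-adjoint for the $\ell^2$ inner product. If $\{\phi_i\}$ is an orthonormal basis of $C(D,\partial D)$ of eigenfunctions of $\Delta_D$ with eigenvalues $\lambda_i$, the Dirichlet heat kernel of $D$ is $\sum_i e^{-\lambda_it}\phi_i(x)\phi_i(y)$ for $x,y\in D$, extended by $0$ when $x$ or $y$ is not in $D$. $p_t^r$ denotes the Dirichlet heat kernel of the ball $B_r=B_r(x_0)$ of radius $r$ (the subgraph induced on the vertices at graph distance at most $r$ from $x_0$); it is pointwise non-decreasing in $r$ and bounded by $1$, so the limit exists. In 8), competing functions are continuous in $t\in[0,\infty)$ and $C^1$ in $t\in(0,\infty)$ for each pair of vertices. *)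

theory Defs
  imports "HOL-Analysis.Analysis"
begin

text \<open>
  A graph is given by its vertex set \<open>V\<close> and its adjacency relation \<open>E\<close>; an undirected edge
  appears in \<open>E\<close> in both orientations. Graphs are without loops and multiple edges.
\<close>

definition simple_graph :: "'v set \<Rightarrow> 'v rel \<Rightarrow> bool" where
  "simple_graph V E \<longleftrightarrow> E \<subseteq> V \<times> V \<and> sym E \<and> irrefl E"

definition locally_finite_graph :: "'v set \<Rightarrow> 'v rel \<Rightarrow> bool" where
  "locally_finite_graph V E \<longleftrightarrow> (\<forall>x\<in>V. finite (E `` {x}))"

definition connected_graph :: "'v set \<Rightarrow> 'v rel \<Rightarrow> bool" where
  "connected_graph V E \<longleftrightarrow> V \<noteq> {} \<and> (\<forall>x\<in>V. \<forall>y\<in>V. (x, y) \<in> E\<^sup>*)"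

definition graph_dist :: "'v rel \<Rightarrow> 'v \<Rightarrow> 'v \<Rightarrow> nat" where
  "graph_dist E x y = (LEAST n. (x, y) \<in> E ^^ n)"

definition graph_ball :: "'v set \<Rightarrow> 'v rel \<Rightarrow> 'v \<Rightarrow> nat \<Rightarrow> 'v set" where
  "graph_ball V E x r = {y \<in> V. graph_dist E x y \<le> r}"

definition laplacian :: "'v rel \<Rightarrow> ('v \<Rightarrow> real) \<Rightarrow> 'v \<Rightarrow> real" where
  "laplacian E f x = (\<Sum>y\<in>E `` {x}. f x - f y)"

text \<open>
  The boundary, the interior, the Dirichlet space, the reduced Laplacian and hence the heat kernel
  of a finite subgraph \<open>D\<close> only depend on the vertex set \<open>W\<close> of \<open>D\<close> and on the adjacency
  relation \<open>E\<close> of the ambient graph. Functions on \<open>W\<close> are represented by their extension by zero.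
\<close>

definition graph_boundary :: "'v rel \<Rightarrow> 'v set \<Rightarrow> 'v set" where
  "graph_boundary E W = {x \<in> W. \<exists>y. (x, y) \<in> E \<and> y \<notin> W}"

definition graph_interior :: "'v rel \<Rightarrow> 'v set \<Rightarrow> 'v set" where
  "graph_interior E W = W - graph_boundary E W"

definition dirichlet_space :: "'v rel \<Rightarrow> 'v set \<Rightarrow> ('v \<Rightarrow> real) set" where
  "dirichlet_space E W = {f. (\<forall>x\<in>graph_boundary E W. f x = 0) \<and> (\<forall>x. x \<notin> W \<longrightarrow> f x = 0)}"

definition reduced_laplacian :: "'v rel \<Rightarrow> 'v set \<Rightarrow> ('v \<Rightarrow> real) \<Rightarrow> 'v \<Rightarrow> real" where
  "reduced_laplacian E W f x = (if x \<in> graph_interior E W then laplacian E f x else 0)"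

definition dirichlet_eigenbasis ::
  "'v rel \<Rightarrow> 'v set \<Rightarrow> nat \<Rightarrow> (nat \<Rightarrow> 'v \<Rightarrow> real) \<Rightarrow> (nat \<Rightarrow> real) \<Rightarrow> bool" where
  "dirichlet_eigenbasis E W n \<phi> ev \<longleftrightarrow>
     (\<forall>i<n. \<phi> i \<in> dirichlet_space E W) \<and>
     (\<forall>i<n. \<forall>j<n. (\<Sum>x\<in>W. \<phi> i x * \<phi> j x) = (if i = j then 1 else 0)) \<and>
     (\<forall>f\<in>dirichlet_space E W. \<exists>c. f = (\<lambda>x. \<Sum>i<n. c i * \<phi> i x)) \<and>
     (\<forall>i<n. \<forall>x. reduced_laplacian E W (\<phi> i) x = ev i * \<phi> i x)"

text \<open>
  For finite \<open>W\<close> an eigenbasis exists because the reduced Laplacian is self-adjoint, and the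
  kernel does not depend on which eigenbasis is chosen.
\<close>

definition dirichlet_heat_kernel :: "'v rel \<Rightarrow> 'v set \<Rightarrow> real \<Rightarrow> 'v \<Rightarrow> 'v \<Rightarrow> real" where
  "dirichlet_heat_kernel E W =
     (SOME k. \<exists>n \<phi> ev. dirichlet_eigenbasis E W n \<phi> ev \<and>
        (\<forall>t x y. k t x y =
           (if x \<in> W \<and> y \<in> W then \<Sum>i<n. exp (- ev i * t) * \<phi> i x * \<phi> i y else 0)))"

definition heat_kernel :: "'v set \<Rightarrow> 'v rel \<Rightarrow> 'v \<Rightarrow> real \<Rightarrow> 'v \<Rightarrow> 'v \<Rightarrow> real" where
  "heat_kernel V E x0 t x y = lim (\<lambda>r. dirichlet_heat_kernel E (graph_ball V E x0 r) t x y)"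

text \<open>
  An increasing sequence of finite connected subgraphs, the \<open>i\<close>-th having vertex set \<open>W i\<close> and
  adjacency relation \<open>F i\<close> (not necessarily an induced subgraph), with union the whole graph.
\<close>

definition graph_exhaustion ::
  "'v set \<Rightarrow> 'v rel \<Rightarrow> (nat \<Rightarrow> 'v set) \<Rightarrow> (nat \<Rightarrow> 'v rel) \<Rightarrow> bool" where
  "graph_exhaustion V E W F \<longleftrightarrow>
     (\<forall>i. simple_graph (W i) (F i) \<and> finite (W i) \<and> connected_graph (W i) (F i)) \<and>
     (\<forall>i. W i \<subseteq> W (Suc i) \<and> F i \<subseteq> F (Suc i)) \<and>
     (\<Union>i. W i) = V \<and> (\<Union>i. F i) = E"

text \<open>
  The heat equation with the Laplacian in the first, respectively second, variable, for times
  in \<open>I\<close>; at the end point \<open>0\<close> of \<open>I = {0..}\<close> the time derivative is one-sided.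
\<close>

definition heat_equation_fst ::
  "'v set \<Rightarrow> 'v rel \<Rightarrow> real set \<Rightarrow> (real \<Rightarrow> 'v \<Rightarrow> 'v \<Rightarrow> real) \<Rightarrow> bool" where
  "heat_equation_fst V E I u \<longleftrightarrow> (\<forall>t\<in>I. \<forall>x\<in>V. \<forall>y\<in>V.
     \<exists>d. ((\<lambda>s. u s x y) has_real_derivative d) (at t within I) \<and>
         laplacian E (\<lambda>z. u t z y) x + d = 0)"

definition heat_equation_snd ::
  "'v set \<Rightarrow> 'v rel \<Rightarrow> real set \<Rightarrow> (real \<Rightarrow> 'v \<Rightarrow> 'v \<Rightarrow> real) \<Rightarrow> bool" where
  "heat_equation_snd V E I u \<longleftrightarrow> (\<forall>t\<in>I. \<forall>x\<in>V. \<forall>y\<in>V.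
     \<exists>d. ((\<lambda>s. u s x y) has_real_derivative d) (at t within I) \<and>
         laplacian E (\<lambda>z. u t x z) y + d = 0)"

definition initial_delta :: "'v set \<Rightarrow> (real \<Rightarrow> 'v \<Rightarrow> 'v \<Rightarrow> real) \<Rightarrow> bool" where
  "initial_delta V u \<longleftrightarrow> (\<forall>x\<in>V. \<forall>y\<in>V. u 0 x y = (if x = y then 1 else 0))"

definition smooth_on_halfline :: "(real \<Rightarrow> real) \<Rightarrow> bool" where
  "smooth_on_halfline f \<longleftrightarrow> (\<exists>D :: nat \<Rightarrow> real \<Rightarrow> real.
     (\<forall>t\<ge>0. D 0 t = f t) \<and>
     (\<forall>k. \<forall>t\<ge>0. (D k has_real_derivative D (Suc k) t) (at t within {0..})))"

text \<open>
  The functions among which the heat kernel is the smallest. The equation is only required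
  in one of the two variables, which makes minimality the stronger claim.
\<close>

definition nonneg_heat_solution ::
  "'v set \<Rightarrow> 'v rel \<Rightarrow> (real \<Rightarrow> 'v \<Rightarrow> 'v \<Rightarrow> real) \<Rightarrow> bool" where
  "nonneg_heat_solution V E u \<longleftrightarrow>
     (\<forall>t\<ge>0. \<forall>x\<in>V. \<forall>y\<in>V. 0 \<le> u t x y) \<and>
     (\<forall>x\<in>V. \<forall>y\<in>V. continuous_on {0..} (\<lambda>t. u t x y) \<and>
        (\<lambda>t. u t x y) C1_differentiable_on {0<..}) \<and>
     (heat_equation_fst V E {0<..} u \<or> heat_equation_snd V E {0<..} u) \<and>
     initial_delta V u"

end

theory Submission
  imports Defs
begin

text \<open>
  The Laplacian restricted to functions supported in the interior of a finite vertex set \<open>W\<close> is a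
  symmetric matrix, so an orthonormal eigenbasis exists and its heat kernel solves the heat equation
  with initial value \<open>\<delta>\<close> on the interior. A parabolic minimum principle on finite sets then shows
  that this kernel is nonnegative, has row sums at most \<open>1\<close>, grows with the interior of \<open>W\<close>, and lies
  below every nonnegative solution on the whole graph with the same initial value. Every finite
  vertex set is contained in the interior of a late member of any exhaustion, so two exhaustions
  dominate each other and have the same limit. The integrated heat equation passes to the limit by
  dominated convergence, as \<open>0 \<le> p \<le> 1\<close> and vertex degrees are finite; since the Laplacian is a
  finite sum, it can then be iterated, which gives smoothness in \<open>t\<close>.
\<close>

section \<open>Eigenbases of symmetric matrices indexed by a finite set\<close>

text \<open>
  A maximizer of the Rayleigh quotient on \<open>U\<close>. As the index type is arbitrary, compactness of the
  unit sphere comes from Tychonoff's theorem: functions supported in \<open>A\<close> with values in \<open>[-1, 1]\<close>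
  form a compact set in the product topology.
\<close>

lemma exists_eigenvector_on_invariant_subspace:
  fixes m :: "'v \<Rightarrow> 'v \<Rightarrow> real" and U :: "('v \<Rightarrow> real) set"
  assumes fin: "finite A"
    and sym: "\<And>x y. x \<in> A \<Longrightarrow> y \<in> A \<Longrightarrow> m x y = m y x"
    and supp: "\<And>f x. f \<in> U \<Longrightarrow> x \<notin> A \<Longrightarrow> f x = 0"
    and lin: "\<And>f g a b. f \<in> U \<Longrightarrow> g \<in> U \<Longrightarrow> (\<lambda>x. a * f x + b * g x) \<in> U"
    and inv: "\<And>f. f \<in> U \<Longrightarrow> (\<lambda>x. if x \<in> A then \<Sum>y\<in>A. m x y * f y else 0) \<in> U"
    and cl: "closed U"
    and h: "h \<in> U" "h \<noteq> (\<lambda>x. 0)"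
  shows "\<exists>f\<in>U. \<exists>ev. (\<Sum>x\<in>A. f x * f x) = 1 \<and>
    (\<forall>x\<in>A. (\<Sum>y\<in>A. m x y * f y) = ev * f x)"
proof -
  define ip where "ip f g = (\<Sum>x\<in>A. f x * g x)" for f g :: "'v \<Rightarrow> real"
  define T where "T f = (\<lambda>x. if x \<in> A then \<Sum>y\<in>A. m x y * f y else 0)" for f
  define Q where "Q f = ip f (T f)" for f
  have ip_comm: "ip f g = ip g f" for f g
    by (simp add: ip_def mult.commute)
  have ip_lin: "ip (\<lambda>x. a * f x + b * g x) k = a * ip f k + b * ip g k" for a b f g k
    by (simp add: ip_def sum.distrib sum_distrib_left algebra_simps)
  have ip_lin_right: "ip k (\<lambda>x. a * f x + b * g x) = a * ip k f + b * ip k g" for a b f g k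
    using ip_comm ip_lin by metis
  have ip_pos: "0 < ip f f" if "f \<in> U" "f \<noteq> (\<lambda>x. 0)" for f
  proof -
    obtain x where "f x \<noteq> 0"
      using \<open>f \<noteq> (\<lambda>x. 0)\<close> by blast
    moreover from this have "x \<in> A"
      using supp \<open>f \<in> U\<close> by blast
    ultimately show ?thesis
      unfolding ip_def using fin by (intro sum_pos2[of A x]) (auto simp: zero_less_mult_iff)
  qed
  have T_lin: "T (\<lambda>x. a * f x + b * g x) = (\<lambda>x. a * T f x + b * T g x)" for a b f g
    by (auto simp: T_def fun_eq_iff sum.distrib sum_distrib_left algebra_simps)
  have T_sym: "ip f (T g) = ip (T f) g" for f g
  proof -
    have "ip f (T g) = (\<Sum>x\<in>A. \<Sum>y\<in>A. f x * m x y * g y)"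
      by (simp add: ip_def T_def sum_distrib_left mult.assoc)
    also have "\<dots> = (\<Sum>y\<in>A. \<Sum>x\<in>A. f x * m x y * g y)"
      by (rule sum.swap)
    also have "\<dots> = ip (T f) g"
      unfolding ip_def T_def
    proof (intro sum.cong refl)
      fix y assume "y \<in> A"
      then have "f x * m x y * g y = m y x * f x * g y" if "x \<in> A" for x
        using sym that by simp
      then have "(\<Sum>x\<in>A. f x * m x y * g y) = (\<Sum>x\<in>A. m y x * f x * g y)"
        by (intro sum.cong refl)
      then show "(\<Sum>x\<in>A. f x * m x y * g y) =
          (if y \<in> A then \<Sum>x\<in>A. m y x * f x else 0) * g y"
        using \<open>y \<in> A\<close> by (simp add: sum_distrib_right)
    qed
    finally show ?thesis .
  qed
  define K where "K = {f. \<forall>x. f x \<in> (if x \<in> A then {-1..1} else {0::real})}"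
  have "compact K"
  proof -
    have "K = (\<Pi>\<^sub>E x\<in>UNIV. if x \<in> A then {-1..1} else {0})"
      unfolding K_def PiE_UNIV_domain Pi_def by simp
    moreover have "compactin (product_topology (\<lambda>x. euclidean) UNIV) \<dots>"
      by (subst compactin_PiE) (auto simp: compactin_euclidean_iff)
    ultimately show ?thesis
      by (simp add: euclidean_product_topology compactin_euclidean_iff)
  qed
  have cont_ip: "continuous_on UNIV (\<lambda>f. ip f f)"
    unfolding ip_def by (intro continuous_intros continuous_on_product_coordinates)
  have cont_Q: "continuous_on UNIV Q"
    unfolding Q_def ip_def T_def by (simp cong: sum.cong, intro continuous_intros continuous_on_product_coordinates)
  have "closed (U \<inter> {f. ip f f = 1})"
    by (intro closed_Int cl closed_Collect_eq cont_ip continuous_intros)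
  then have comp: "compact (K \<inter> (U \<inter> {f. ip f f = 1}))"
    using \<open>compact K\<close> by blast
  have inK: "f \<in> K" if "f \<in> U" "ip f f = 1" for f
  proof -
    have "\<bar>f x\<bar> \<le> 1" if "x \<in> A" for x
    proof -
      have "f x * f x \<le> ip f f"
        unfolding ip_def using fin that by (intro member_le_sum) auto
      then show ?thesis
        using \<open>ip f f = 1\<close> abs_square_le_1[of "f x"] by (simp only: power2_eq_square)
    qed
    then show ?thesis
      using supp \<open>f \<in> U\<close> by (auto simp: K_def abs_le_iff minus_le_iff)
  qed
  have scale: "(\<lambda>x. c * f x) \<in> U" if "f \<in> U" for c f
    using lin[OF that that, of c 0] by simp
  have ip_scale: "ip (\<lambda>x. c * f x) (\<lambda>x. c * f x) = c * c * ip f f" for c f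
    by (simp add: ip_def sum_distrib_left mult_ac)
  have normalized: "\<exists>c>0. c * c * ip f f = 1" if "f \<in> U" "f \<noteq> (\<lambda>x. 0)" for f
    using ip_pos[OF that] by (intro exI[of _ "1 / sqrt (ip f f)"]) simp
  have "K \<inter> (U \<inter> {f. ip f f = 1}) \<noteq> {}"
    using normalized[OF h] inK scale[OF h(1)] ip_scale[of _ h] by force
  then obtain f where f: "f \<in> U" "ip f f = 1"
    and max: "\<And>g. g \<in> U \<Longrightarrow> ip g g = 1 \<Longrightarrow> Q g \<le> Q f"
    using continuous_attains_sup[OF comp _ continuous_on_subset[OF cont_Q]] inK by blast
  have Q_lin: "Q (\<lambda>x. a * f x + b * g x) = a * a * Q f + 2 * a * b * ip (T f) g + b * b * Q g" for a b f g
    using T_sym[of f g] ip_comm[of g "T f"]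
    by (simp add: Q_def T_lin ip_lin ip_lin_right algebra_simps)
  have ip_lin2: "ip (\<lambda>x. a * f x + b * g x) (\<lambda>x. a * f x + b * g x) = a * a * ip f f + 2 * a * b * ip f g + b * b * ip g g" for a b f g
    using ip_comm[of g f] by (simp add: ip_lin ip_lin_right algebra_simps)
  \<comment> \<open>Rescaling to unit norm turns maximality of \<open>f\<close> on the sphere into a
    homogeneous inequality on all of \<open>U\<close>, which can be tested on \<open>f + s g\<close>
    without normalizing.\<close>
  have rayleigh: "Q g \<le> Q f * ip g g" if "g \<in> U" for g
  proof (cases "g = (\<lambda>x. 0)")
    case True
    then show ?thesis by (simp add: Q_def ip_def)
  next
    case False
    obtain c where c: "0 < c" "c * c * ip g g = 1"
      using normalized[OF \<open>g \<in> U\<close> False] by blast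
    have "c * c * Q g \<le> Q f"
      using max[OF scale[OF that, of c]] c(2) Q_lin[of c g 0 g] by (simp add: ip_scale)
    also have "\<dots> = c * c * (Q f * ip g g)"
      using c(2) by (metis mult.commute mult.left_commute mult.right_neutral)
    finally show ?thesis
      using \<open>0 < c\<close> by (simp add: mult_le_cancel_left)
  qed
  \<comment> \<open>The residual of the eigenvalue equation, half the gradient of
    \<open>Q - Q f * ip\<close> at \<open>f\<close>. The explicit coefficients make it an instance
    of \<open>lin\<close> and \<open>ip_lin\<close>.\<close>
  define k where "k = (\<lambda>x. 1 * T f x + (- Q f) * f x)"
  have "k \<in> U"
    unfolding k_def using lin[OF inv[OF f(1)] f(1)] by (simp only: T_def)
  \<comment> \<open>Lagrange condition: comparing with \<open>f + s g\<close> for small \<open>s\<close> makes the gradient vanish.\<close>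
  have key: "ip k g = 0" if "g \<in> U" for g
  proof -
    have le: "2 * s * ip k g \<le> s * s * (Q f * ip g g - Q g)" for s
    proof -
      have "Q (\<lambda>x. 1 * f x + s * g x) \<le> Q f * ip (\<lambda>x. 1 * f x + s * g x) (\<lambda>x. 1 * f x + s * g x)"
        by (intro rayleigh lin f that)
      then show ?thesis
        unfolding Q_lin ip_lin2 k_def ip_lin using f(2) by (simp add: algebra_simps)
    qed
    define C where "C = Q f * ip g g - Q g"
    have "0 \<le> C" using rayleigh[OF that] by (simp add: C_def)
    \<comment> \<open>With this \<open>s\<close> the inequality \<open>le\<close> collapses to
      \<open>s * s * (C + 2) \<le> 0\<close>; the \<open>+ 1\<close> keeps the denominator positive
      when \<open>C = 0\<close>.\<close>
    define s where "s = ip k g / (C + 1)"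
    have s: "ip k g = s * (C + 1)"
      using \<open>0 \<le> C\<close> by (simp add: s_def)
    have "2 * s * (s * (C + 1)) \<le> s * s * C"
      using le[of s] by (simp add: C_def[symmetric] s)
    then have "s * s * (C + 2) \<le> 0"
      by (simp add: algebra_simps)
    then have "s = 0"
      using \<open>0 \<le> C\<close> mult_le_0_iff[of "s * s" "C + 2"] zero_le_square[of s] by auto
    then show ?thesis using s by simp
  qed
  have "ip k k = 0"
    using key \<open>k \<in> U\<close> by blast
  then have "k = (\<lambda>x. 0)"
    using ip_pos[OF \<open>k \<in> U\<close>] by fastforce
  then have "T f x = Q f * f x" for x
    by (auto simp: k_def fun_eq_iff)
  then have "(\<Sum>y\<in>A. m x y * f y) = Q f * f x" if "x \<in> A" for x
    using that by (metis T_def)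
  then show ?thesis
    using f by (auto simp: ip_def)
qed

text \<open>Spanning is left out on purpose, so that incomplete systems can be compared by size and
  extended by one vector.\<close>

definition orthonormal_eigensystem ::
  "'v set \<Rightarrow> ('v \<Rightarrow> 'v \<Rightarrow> real) \<Rightarrow> nat \<Rightarrow> (nat \<Rightarrow> 'v \<Rightarrow> real) \<Rightarrow> (nat \<Rightarrow> real) \<Rightarrow> bool" where
  "orthonormal_eigensystem A m n \<phi> ev \<longleftrightarrow>
     (\<forall>i<n. \<forall>x. x \<notin> A \<longrightarrow> \<phi> i x = 0) \<and>
     (\<forall>i<n. \<forall>j<n. (\<Sum>x\<in>A. \<phi> i x * \<phi> j x) = (if i = j then 1 else 0)) \<and>
     (\<forall>i<n. \<forall>x\<in>A. (\<Sum>y\<in>A. m x y * \<phi> i y) = ev i * \<phi> i x)"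

text \<open>Bessel's inequality for the point mass at \<open>x\<close> bounds the sum of the squares
  \<open>\<phi> i x * \<phi> i x\<close> by 1; summing over \<open>x\<close> counts the vectors. The
  bound makes a system of maximal size available.\<close>

lemma orthonormal_eigensystem_card:
  assumes fin: "finite A" and sys: "orthonormal_eigensystem A m n \<phi> ev"
  shows "n \<le> card A"
proof -
  have orth: "(\<Sum>x\<in>A. \<phi> i x * \<phi> j x) = (if i = j then 1 else 0)" if "i < n" "j < n" for i j
    using sys that by (auto simp: orthonormal_eigensystem_def)
  have bessel: "(\<Sum>i<n. \<phi> i x * \<phi> i x) \<le> 1" if "x \<in> A" for x
  proof -
    define d where "d y = (if y = x then 1 else 0 :: real)" for y
    \<comment> \<open>\<open>g\<close> is the orthogonal projection of the point mass
      \<open>d\<close> onto the span of the system.\<close>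
    define g where "g y = (\<Sum>i<n. \<phi> i x * \<phi> i y)" for y
    have dg: "(\<Sum>y\<in>A. d y * g y) = g x" "(\<Sum>y\<in>A. d y * d y) = 1"
      using fin that by (simp_all add: d_def if_distrib[where f="\<lambda>z. z * _"] cong: if_cong)
    have "(\<Sum>y\<in>A. g y * g y) = (\<Sum>y\<in>A. \<Sum>i<n. \<Sum>j<n. (\<phi> i x * \<phi> j x) * (\<phi> i y * \<phi> j y))"
      by (simp add: g_def sum_product mult_ac)
    also have "\<dots> = (\<Sum>i<n. \<Sum>y\<in>A. \<Sum>j<n. (\<phi> i x * \<phi> j x) * (\<phi> i y * \<phi> j y))"
      by (rule sum.swap)
    also have "\<dots> = (\<Sum>i<n. \<Sum>j<n. \<Sum>y\<in>A. (\<phi> i x * \<phi> j x) * (\<phi> i y * \<phi> j y))"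
      by (intro sum.cong refl sum.swap)
    also have "\<dots> = (\<Sum>i<n. \<Sum>j<n. (\<phi> i x * \<phi> j x) * (if i = j then 1 else 0))"
      by (auto intro!: sum.cong simp: sum_distrib_left[symmetric] orth)
    also have "\<dots> = g x"
      by (simp add: g_def if_distrib cong: if_cong)
    finally have gg: "(\<Sum>y\<in>A. g y * g y) = g x" .
    have "0 \<le> (\<Sum>y\<in>A. (d y - g y) * (d y - g y))"
      by (simp add: sum_nonneg)
    also have "\<dots> = (\<Sum>y\<in>A. d y * d y) - 2 * (\<Sum>y\<in>A. d y * g y) + (\<Sum>y\<in>A. g y * g y)"
      by (simp add: algebra_simps sum.distrib sum_subtractf sum_distrib_left)
    finally show ?thesis
      using dg gg by (simp add: g_def)
  qed
  have "real n = (\<Sum>i<n. \<Sum>x\<in>A. \<phi> i x * \<phi> i x)"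
    by (simp add: orth)
  also have "\<dots> = (\<Sum>x\<in>A. \<Sum>i<n. \<phi> i x * \<phi> i x)"
    by (rule sum.swap)
  also have "\<dots> \<le> (\<Sum>x\<in>A. 1)"
    by (intro sum_mono bessel)
  finally show ?thesis by simp
qed

text \<open>Symmetry of \<open>m\<close> makes the orthogonal complement of an eigensystem
  invariant, so a nonzero complement would supply one more eigenvector.\<close>

lemma orthonormal_eigenbasis_exists:
  fixes m :: "'v \<Rightarrow> 'v \<Rightarrow> real"
  assumes fin: "finite A"
    and sym: "\<And>x y. x \<in> A \<Longrightarrow> y \<in> A \<Longrightarrow> m x y = m y x"
  obtains n \<phi> ev where "orthonormal_eigensystem A m n \<phi> ev"
    "\<And>f. (\<And>x. x \<notin> A \<Longrightarrow> f x = 0) \<Longrightarrow> \<exists>c. f = (\<lambda>x. \<Sum>i<n. c i * \<phi> i x)"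
proof -
  \<comment> \<open>An orthonormal eigensystem of maximal size spans.\<close>
  define P where "P n \<longleftrightarrow> (\<exists>\<phi> ev. orthonormal_eigensystem A m n \<phi> ev)" for n
  have "P 0" by (simp add: P_def orthonormal_eigensystem_def)
  then obtain n where "P n" and greatest: "\<And>k. P k \<Longrightarrow> k \<le> n"
    using Nat.ex_has_greatest_nat[of P 0 "card A"] orthonormal_eigensystem_card[OF fin]
    unfolding P_def by metis
  then obtain \<phi> ev where sys: "orthonormal_eigensystem A m n \<phi> ev"
    by (auto simp: P_def)
  have supp: "\<phi> i x = 0" if "i < n" "x \<notin> A" for i x
    using sys that by (auto simp: orthonormal_eigensystem_def)
  have orth: "(\<Sum>x\<in>A. \<phi> i x * \<phi> j x) = (if i = j then 1 else 0)" if "i < n" "j < n" for i j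
    using sys that by (auto simp: orthonormal_eigensystem_def)
  have eig: "(\<Sum>y\<in>A. m x y * \<phi> i y) = ev i * \<phi> i x" if "i < n" "x \<in> A" for i x
    using sys that by (auto simp: orthonormal_eigensystem_def)
  define U where "U = {f. (\<forall>x. x \<notin> A \<longrightarrow> f x = 0) \<and> (\<forall>i<n. (\<Sum>x\<in>A. f x * \<phi> i x) = 0)}"
  have trivial: "h = (\<lambda>x. 0)" if "h \<in> U" for h
  proof (rule ccontr)
    assume nz: "h \<noteq> (\<lambda>x. 0)"
    have cl: "closed U"
      unfolding U_def
      by (intro closed_Collect_conj closed_Collect_all closed_Collect_imp closed_Collect_eq
            open_Collect_const continuous_intros continuous_on_product_coordinates)
    have lin: "(\<lambda>x. a * f x + b * g x) \<in> U" if "f \<in> U" "g \<in> U" for a b f g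
      using that by (auto simp: U_def algebra_simps sum.distrib sum_distrib_left[symmetric])
    have inv: "(\<lambda>x. if x \<in> A then \<Sum>y\<in>A. m x y * f y else 0) \<in> U" if "f \<in> U" for f
    proof -
      have "(\<Sum>x\<in>A. (\<Sum>y\<in>A. m x y * f y) * \<phi> i x) = 0" if "i < n" for i
      proof -
        have "(\<Sum>x\<in>A. (\<Sum>y\<in>A. m x y * f y) * \<phi> i x) = (\<Sum>x\<in>A. \<Sum>y\<in>A. f y * (m y x * \<phi> i x))"
          unfolding sum_distrib_right by (intro sum.cong refl) (simp add: sym)
        also have "\<dots> = (\<Sum>y\<in>A. \<Sum>x\<in>A. f y * (m y x * \<phi> i x))"
          by (rule sum.swap)
        also have "\<dots> = (\<Sum>y\<in>A. ev i * (f y * \<phi> i y))"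
          using that by (intro sum.cong refl) (simp add: sum_distrib_left[symmetric] eig)
        also have "\<dots> = 0"
          using that \<open>f \<in> U\<close> by (simp add: sum_distrib_left[symmetric] U_def)
        finally show ?thesis .
      qed
      then show ?thesis
        by (auto simp: U_def)
    qed
    have supp_U: "f x = 0" if "f \<in> U" "x \<notin> A" for f x
      using that by (auto simp: U_def)
    have "\<exists>f\<in>U. \<exists>l. (\<Sum>x\<in>A. f x * f x) = 1 \<and>
        (\<forall>x\<in>A. (\<Sum>y\<in>A. m x y * f y) = l * f x)"
      by (rule exists_eigenvector_on_invariant_subspace)
        (fact fin sym supp_U lin inv cl \<open>h \<in> U\<close> nz)+
    then obtain f l where f: "f \<in> U" "(\<Sum>x\<in>A. f x * f x) = 1"
      "\<And>x. x \<in> A \<Longrightarrow> (\<Sum>y\<in>A. m x y * f y) = l * f x"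
      by blast
    have "orthonormal_eigensystem A m (Suc n) (\<phi>(n := f)) (ev(n := l))"
      using f supp orth eig
      by (auto simp: orthonormal_eigensystem_def less_Suc_eq U_def mult.commute)
    then have "P (Suc n)" by (auto simp: P_def)
    then show False using greatest by fastforce
  qed
  have "\<exists>c. f = (\<lambda>x. \<Sum>i<n. c i * \<phi> i x)" if "\<And>x. x \<notin> A \<Longrightarrow> f x = 0" for f
  proof -
    \<comment> \<open>Fourier coefficients: what remains of \<open>f\<close> after subtracting its
      expansion is orthogonal to the system, hence lies in the trivial space
      \<open>U\<close>.\<close>
    define c where "c i = (\<Sum>x\<in>A. f x * \<phi> i x)" for i
    have "(\<Sum>x\<in>A. (f x - (\<Sum>i<n. c i * \<phi> i x)) * \<phi> j x) = 0" if "j < n" for j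
    proof -
      have "(\<Sum>x\<in>A. (\<Sum>i<n. c i * \<phi> i x) * \<phi> j x) = (\<Sum>i<n. \<Sum>x\<in>A. c i * (\<phi> i x * \<phi> j x))"
        by (subst sum.swap) (simp add: sum_distrib_right mult.assoc)
      also have "\<dots> = (\<Sum>i<n. c i * (if i = j then 1 else 0))"
        using that by (auto intro!: sum.cong simp: sum_distrib_left[symmetric] orth)
      also have "\<dots> = c j"
        using that by (simp add: if_distrib cong: if_cong)
      finally show ?thesis
        by (simp add: left_diff_distrib sum_subtractf c_def)
    qed
    then have "(\<lambda>x. f x - (\<Sum>i<n. c i * \<phi> i x)) \<in> U"
      using that supp by (auto simp: U_def)
    from trivial[OF this] show ?thesis
      by (intro exI[of _ c]) (simp add: fun_eq_iff)
  qed
  then show ?thesis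
    using that sys by blast
qed


section \<open>Dirichlet heat kernels of finite sets\<close>

text \<open>Finiteness is asked at every element of the type. For
  \<open>E \<subseteq> V \<times> V\<close> this agrees with local finiteness on \<open>V\<close>,
  as other elements have no neighbors.\<close>

locale locally_finite_network =
  fixes E :: "'v rel"
  assumes sym_E: "sym E" and finite_neighbors: "finite (E `` {x})"
begin

section \<open>Algebra of the Laplacian and its matrix\<close>

lemma laplacian_diff:
  "laplacian E (\<lambda>z. f z - g z) x = laplacian E f x - laplacian E g x"
  by (simp add: laplacian_def sum_subtractf[symmetric] algebra_simps)

lemma laplacian_const: "laplacian E (\<lambda>z. c) x = 0"
  by (simp add: laplacian_def)

lemma laplacian_sum:
  "laplacian E (\<lambda>z. \<Sum>i\<in>I. c i * f i z) x = (\<Sum>i\<in>I. c i * laplacian E (f i) x)"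
proof -
  have "laplacian E (\<lambda>z. \<Sum>i\<in>I. c i * f i z) x = (\<Sum>y\<in>E `` {x}. \<Sum>i\<in>I. c i * (f i x - f i y))"
    by (simp add: laplacian_def sum_subtractf[symmetric] right_diff_distrib)
  also have "\<dots> = (\<Sum>i\<in>I. c i * laplacian E (f i) x)"
    by (subst sum.swap) (simp add: laplacian_def sum_distrib_left)
  finally show ?thesis .
qed

text \<open>Degree matrix minus adjacency matrix. Neighbors outside \<open>A\<close> carry the value
  0, so they enter only through the full degree on the diagonal.\<close>

lemma laplacian_matrix:
  assumes "finite A" "x \<in> A" and supp: "\<And>z. z \<notin> A \<Longrightarrow> f z = 0"
  shows "laplacian E f x =
    (\<Sum>y\<in>A. ((if x = y then real (card (E `` {x})) else 0) - (if (x, y) \<in> E then 1 else 0)) * f y)"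
proof -
  have "(\<Sum>y\<in>E `` {x}. f y) = (\<Sum>y\<in>A \<inter> E `` {x}. f y)"
    using finite_neighbors supp by (intro sum.mono_neutral_right) auto
  also have "\<dots> = (\<Sum>y\<in>A. (if (x, y) \<in> E then 1 else 0) * f y)"
    using \<open>finite A\<close> by (auto simp: sum.inter_restrict intro!: sum.cong)
  finally have nbr: "(\<Sum>y\<in>E `` {x}. f y) = (\<Sum>y\<in>A. (if (x, y) \<in> E then 1 else 0) * f y)" .
  have "(\<Sum>y\<in>A. (if x = y then real (card (E `` {x})) else 0) * f y) = real (card (E `` {x})) * f x"
    using assms by (simp add: if_distrib[where f="\<lambda>z. z * _"] cong: if_cong)
  then show ?thesis
    using nbr by (simp add: laplacian_def sum_subtractf left_diff_distrib)
qed

text \<open>Merges the two vanishing conditions into one support condition, so that the eigenvalue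
  problem lives on a single index set.\<close>

lemma dirichlet_space_interior:
  "dirichlet_space E W = {f. \<forall>x. x \<notin> graph_interior E W \<longrightarrow> f x = 0}"
  by (auto simp: dirichlet_space_def graph_interior_def graph_boundary_def)

lemma graph_interior_subset: "graph_interior E W \<subseteq> W"
  by (auto simp: graph_interior_def)

lemma finite_graph_interior: "finite W \<Longrightarrow> finite (graph_interior E W)"
  by (rule finite_subset[OF graph_interior_subset])

text \<open>The matrix of \<open>laplacian_matrix\<close> is symmetric because \<open>E\<close> is.
  Extending eigenvectors by zero from the interior changes no inner product, and off the interior
  both sides of the eigenvalue equation vanish.\<close>

lemma dirichlet_eigenbasis_exists:
  assumes "finite W"
  shows "\<exists>n \<phi> ev. dirichlet_eigenbasis E W n \<phi> ev"
proof -
  define A where "A = graph_interior E W"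
  define m :: "'v \<Rightarrow> 'v \<Rightarrow> real" where
    "m x y = (if x = y then real (card (E `` {x})) else 0) - (if (x, y) \<in> E then 1 else 0)" for x y
  have "finite A" "A \<subseteq> W"
    using assms by (simp_all add: A_def graph_interior_subset finite_graph_interior)
  have "m x y = m y x" for x y
    using sym_E by (auto simp: m_def dest: symD)
  then obtain n \<phi> ev where sys: "orthonormal_eigensystem A m n \<phi> ev"
    and span: "\<And>f. (\<And>x. x \<notin> A \<Longrightarrow> f x = 0) \<Longrightarrow> \<exists>c. f = (\<lambda>x. \<Sum>i<n. c i * \<phi> i x)"
    using orthonormal_eigenbasis_exists[OF \<open>finite A\<close>, of m] by blast
  have supp: "\<phi> i x = 0" if "i < n" "x \<notin> A" for i x
    using sys that by (auto simp: orthonormal_eigensystem_def)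
  have "(\<Sum>x\<in>W. \<phi> i x * \<phi> j x) = (\<Sum>x\<in>A. \<phi> i x * \<phi> j x)" if "i < n" for i j
    using assms \<open>A \<subseteq> W\<close> supp that by (intro sum.mono_neutral_right) auto
  then have orth: "(\<Sum>x\<in>W. \<phi> i x * \<phi> j x) = (if i = j then 1 else 0)" if "i < n" "j < n" for i j
    using sys that by (auto simp: orthonormal_eigensystem_def)
  have "reduced_laplacian E W (\<phi> i) x = ev i * \<phi> i x" if "i < n" for i x
    using sys that laplacian_matrix[OF \<open>finite A\<close>, of x "\<phi> i"] supp
    by (auto simp: reduced_laplacian_def A_def[symmetric] orthonormal_eigensystem_def m_def)
  then have "dirichlet_eigenbasis E W n \<phi> ev"
    using supp orth span by (auto simp: dirichlet_eigenbasis_def dirichlet_space_interior A_def)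
  then show ?thesis by blast
qed

text \<open>Resolves the \<open>SOME\<close> in the definition once and for all. The case
  distinction on \<open>W\<close> disappears because eigenfunctions vanish off
  \<open>W\<close>.\<close>

lemma dirichlet_heat_kernel_expansion:
  assumes "finite W"
  obtains n \<phi> ev where "dirichlet_eigenbasis E W n \<phi> ev"
    "dirichlet_heat_kernel E W = (\<lambda>t x y. \<Sum>i<n. exp (- ev i * t) * \<phi> i x * \<phi> i y)"
proof -
  let ?P = "\<lambda>k. \<exists>n \<phi> ev. dirichlet_eigenbasis E W n \<phi> ev \<and>
    (\<forall>t x y. k t x y = (if x \<in> W \<and> y \<in> W then \<Sum>i<n. exp (- ev i * t) * \<phi> i x * \<phi> i y else 0))"
  obtain n \<phi> ev where "dirichlet_eigenbasis E W n \<phi> ev"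
    using dirichlet_eigenbasis_exists[OF assms] by blast
  then have "?P (\<lambda>t x y. if x \<in> W \<and> y \<in> W then \<Sum>i<n. exp (- ev i * t) * \<phi> i x * \<phi> i y else 0)"
    by blast
  then have "?P (dirichlet_heat_kernel E W)"
    unfolding dirichlet_heat_kernel_def by (rule someI[of ?P])
  then obtain n \<phi> ev where basis: "dirichlet_eigenbasis E W n \<phi> ev"
    and K: "\<And>t x y. dirichlet_heat_kernel E W t x y =
      (if x \<in> W \<and> y \<in> W then \<Sum>i<n. exp (- ev i * t) * \<phi> i x * \<phi> i y else 0)"
    by blast
  have supp: "\<phi> i x = 0" if "i < n" "x \<notin> graph_interior E W" for i x
    using basis that by (auto simp: dirichlet_eigenbasis_def dirichlet_space_interior)
  then have "\<phi> i x = 0" if "i < n" "x \<notin> W" for i x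
    using that graph_interior_subset by blast
  then have "dirichlet_heat_kernel E W = (\<lambda>t x y. \<Sum>i<n. exp (- ev i * t) * \<phi> i x * \<phi> i y)"
    by (auto simp: K fun_eq_iff)
  then show ?thesis
    using that basis by blast
qed

section \<open>Spectral properties of the kernel of a finite set\<close>

lemma dirichlet_heat_kernel_commute:
  assumes "finite W"
  shows "dirichlet_heat_kernel E W t x y = dirichlet_heat_kernel E W t y x"
  by (rule dirichlet_heat_kernel_expansion[OF assms]) (simp add: mult_ac)

lemma dirichlet_heat_kernel_outside_left:
  assumes "finite W" "x \<notin> graph_interior E W"
  shows "dirichlet_heat_kernel E W t x y = 0"
proof -
  obtain n \<phi> ev where "dirichlet_eigenbasis E W n \<phi> ev"
    and K: "dirichlet_heat_kernel E W = (\<lambda>t x y. \<Sum>i<n. exp (- ev i * t) * \<phi> i x * \<phi> i y)"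
    using dirichlet_heat_kernel_expansion[OF assms(1)] by blast
  then have "\<phi> i x = 0" if "i < n" for i
    using that assms(2) by (auto simp: dirichlet_eigenbasis_def dirichlet_space_interior)
  then show ?thesis by (simp add: K)
qed

text \<open>Each summand satisfies the equation because the reduced Laplacian agrees with the full
  one at interior \<open>x\<close>. At a boundary vertex the kernel is constantly 0 while its
  Laplacian may be negative.\<close>

lemma dirichlet_heat_kernel_deriv:
  assumes "finite W" "x \<in> graph_interior E W"
  shows "((\<lambda>s. dirichlet_heat_kernel E W s x y) has_real_derivative
    - laplacian E (\<lambda>z. dirichlet_heat_kernel E W t z y) x) (at t within S)"
proof -
  obtain n \<phi> ev where basis: "dirichlet_eigenbasis E W n \<phi> ev"
    and K: "dirichlet_heat_kernel E W = (\<lambda>t x y. \<Sum>i<n. exp (- ev i * t) * \<phi> i x * \<phi> i y)"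
    using dirichlet_heat_kernel_expansion[OF assms(1)] by blast
  have eig: "laplacian E (\<phi> i) x = ev i * \<phi> i x" if "i < n" for i
    using basis that assms(2) unfolding dirichlet_eigenbasis_def reduced_laplacian_def by metis
  have "laplacian E (\<lambda>z. dirichlet_heat_kernel E W t z y) x =
      laplacian E (\<lambda>z. \<Sum>i<n. (exp (- ev i * t) * \<phi> i y) * \<phi> i z) x"
    by (simp add: K mult_ac)
  also have "\<dots> = (\<Sum>i<n. (exp (- ev i * t) * \<phi> i y) * (ev i * \<phi> i x))"
    unfolding laplacian_sum by (simp add: eig)
  finally have "- laplacian E (\<lambda>z. dirichlet_heat_kernel E W t z y) x =
      (\<Sum>i<n. (exp (- ev i * t) * (- ev i)) * \<phi> i x * \<phi> i y)"
    by (simp add: sum_negf mult_ac)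
  moreover have "((\<lambda>s. dirichlet_heat_kernel E W s x y) has_real_derivative
      (\<Sum>i<n. (exp (- ev i * t) * (- ev i)) * \<phi> i x * \<phi> i y)) (at t within S)"
    unfolding K by (intro DERIV_sum) (auto intro!: derivative_eq_intros)
  ultimately show ?thesis by simp
qed

lemma dirichlet_heat_kernel_continuous:
  assumes "finite W"
  shows "continuous_on S (\<lambda>t. dirichlet_heat_kernel E W t x y)"
  by (rule dirichlet_heat_kernel_expansion[OF assms]) (simp, intro continuous_intros)

text \<open>
  Only points of the interior qualify: the Dirichlet heat kernel vanishes on the boundary even at
  time \<open>0\<close>.
\<close>

lemma dirichlet_heat_kernel_0:
  assumes "finite W" "x \<in> graph_interior E W"
  shows "dirichlet_heat_kernel E W 0 x y = (if x = y then 1 else 0)"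
proof -
  obtain n \<phi> ev where basis: "dirichlet_eigenbasis E W n \<phi> ev"
    and K: "dirichlet_heat_kernel E W = (\<lambda>t x y. \<Sum>i<n. exp (- ev i * t) * \<phi> i x * \<phi> i y)"
    using dirichlet_heat_kernel_expansion[OF assms(1)] by blast
  \<comment> \<open>Expanding the point mass at \<open>x\<close> in the eigenbasis: orthonormality
    forces the coefficients to be \<open>\<phi> j x\<close>, and the expansion becomes the kernel at
    time 0.\<close>
  define d where "d z = (if z = x then 1 else 0 :: real)" for z
  have "d \<in> dirichlet_space E W"
    using assms(2) by (auto simp: d_def dirichlet_space_interior)
  then obtain c where c: "d = (\<lambda>z. \<Sum>i<n. c i * \<phi> i z)"
    using basis unfolding dirichlet_eigenbasis_def by blast
  have "c j = \<phi> j x" if "j < n" for j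
  proof -
    have "\<phi> j x = (\<Sum>z\<in>W. d z * \<phi> j z)"
      using assms graph_interior_subset[of W]
      by (auto simp: d_def if_distrib[where f="\<lambda>z. z * _"] cong: if_cong)
    also have "\<dots> = (\<Sum>i<n. \<Sum>z\<in>W. c i * (\<phi> i z * \<phi> j z))"
      by (subst sum.swap) (simp add: c sum_distrib_right mult.assoc)
    also have "\<dots> = (\<Sum>i<n. c i * (if i = j then 1 else 0))"
      using basis that unfolding dirichlet_eigenbasis_def by (simp add: sum_distrib_left[symmetric])
    also have "\<dots> = c j"
      using that by (simp add: if_distrib cong: if_cong)
    finally show ?thesis by simp
  qed
  then have "d y = (\<Sum>i<n. \<phi> i x * \<phi> i y)"
    by (simp add: c)
  then show ?thesis
    by (auto simp: K d_def)
qed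

text \<open>Orthonormality collapses the double sum to its diagonal, where the exponentials
  multiply.\<close>

lemma dirichlet_heat_kernel_semigroup:
  assumes "finite W"
  shows "(\<Sum>z\<in>W. dirichlet_heat_kernel E W s x z * dirichlet_heat_kernel E W t z y) =
    dirichlet_heat_kernel E W (s + t) x y"
proof -
  obtain n \<phi> ev where basis: "dirichlet_eigenbasis E W n \<phi> ev"
    and K: "dirichlet_heat_kernel E W = (\<lambda>t x y. \<Sum>i<n. exp (- ev i * t) * \<phi> i x * \<phi> i y)"
    using dirichlet_heat_kernel_expansion[OF assms(1)] by blast
  have orth: "(\<Sum>z\<in>W. \<phi> i z * \<phi> j z) = (if i = j then 1 else 0)" if "i < n" "j < n" for i j
    using basis that unfolding dirichlet_eigenbasis_def by blast
  define a where "a i = exp (- ev i * s) * \<phi> i x" for i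
  define b where "b i = exp (- ev i * t) * \<phi> i y" for i
  have "(\<Sum>z\<in>W. dirichlet_heat_kernel E W s x z * dirichlet_heat_kernel E W t z y) =
      (\<Sum>z\<in>W. \<Sum>i<n. \<Sum>j<n. (a i * b j) * (\<phi> i z * \<phi> j z))"
    by (simp add: K a_def b_def sum_product mult_ac)
  also have "\<dots> = (\<Sum>i<n. \<Sum>z\<in>W. \<Sum>j<n. (a i * b j) * (\<phi> i z * \<phi> j z))"
    by (rule sum.swap)
  also have "\<dots> = (\<Sum>i<n. \<Sum>j<n. \<Sum>z\<in>W. (a i * b j) * (\<phi> i z * \<phi> j z))"
    by (intro sum.cong refl sum.swap)
  also have "\<dots> = (\<Sum>i<n. \<Sum>j<n. (a i * b j) * (if i = j then 1 else 0))"
    by (simp add: sum_distrib_left[symmetric] orth)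
  also have "\<dots> = (\<Sum>i<n. a i * b i)"
    by (simp add: if_distrib cong: if_cong)
  also have "\<dots> = dirichlet_heat_kernel E W (s + t) x y"
    by (simp add: K a_def b_def distrib_left exp_add exp_diff exp_minus field_simps)
  finally show ?thesis .
qed

text \<open>
  The perturbation \<open>\<epsilon> t\<close> makes \<open>u\<close> a strict supersolution, which excludes a negative minimum over
  \<open>A \<times> [0, T]\<close>: there the Laplacian and the time derivative would both be nonpositive.
\<close>

lemma minimum_principle:
  fixes u :: "real \<Rightarrow> 'v \<Rightarrow> real"
  assumes fin: "finite A"
    and cont: "\<And>x. x \<in> A \<Longrightarrow> continuous_on {0..} (\<lambda>t. u t x)"
    and super: "\<And>t x. t > 0 \<Longrightarrow> x \<in> A \<Longrightarrow>
      \<exists>d. ((\<lambda>s. u s x) has_real_derivative d) (at t) \<and> 0 \<le> laplacian E (u t) x + d"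
    and init: "\<And>x. x \<in> A \<Longrightarrow> 0 \<le> u 0 x"
    and bdry: "\<And>t x y. t \<ge> 0 \<Longrightarrow> x \<in> A \<Longrightarrow> (x, y) \<in> E \<Longrightarrow> y \<notin> A \<Longrightarrow> 0 \<le> u t y"
    and "T \<ge> 0" "a \<in> A"
  shows "0 \<le> u T a"
proof (rule ccontr)
  assume neg: "\<not> 0 \<le> u T a"
  \<comment> \<open>Chosen so that \<open>u T a + \<epsilon> * T = - \<epsilon>\<close>, leaving the
    perturbed function negative at \<open>(T, a)\<close>.\<close>
  define \<epsilon> where "\<epsilon> = - u T a / (T + 1)"
  have "\<epsilon> > 0" using neg \<open>T \<ge> 0\<close> by (simp add: \<epsilon>_def divide_neg_pos)
  have "\<epsilon> * (T + 1) = - u T a"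
    using \<open>T \<ge> 0\<close> by (simp add: \<epsilon>_def)
  then have neg': "u T a + \<epsilon> * T < 0"
    using \<open>\<epsilon> > 0\<close> by (simp add: algebra_simps)
  define v where "v t x = u t x + \<epsilon> * t" for t x
  have "\<exists>t\<in>{0..T}. \<forall>s\<in>{0..T}. v t x \<le> v s x" if "x \<in> A" for x
    unfolding v_def using \<open>T \<ge> 0\<close> that
    by (intro continuous_attains_inf continuous_intros continuous_on_subset[OF cont]) auto
  \<comment> \<open>Minimize over time at each vertex first, then over the finitely many vertices;
    this yields a minimum of \<open>v\<close> over \<open>A\<close> and
    \<open>[0, T]\<close>.\<close>
  then obtain \<tau> where \<tau>: "\<And>x. x \<in> A \<Longrightarrow> \<tau> x \<in> {0..T}"
    "\<And>x s. x \<in> A \<Longrightarrow> s \<in> {0..T} \<Longrightarrow> v (\<tau> x) x \<le> v s x"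
    by metis
  obtain b where b: "b \<in> A" "\<And>x. x \<in> A \<Longrightarrow> v (\<tau> b) b \<le> v (\<tau> x) x"
    by (rule that[of "arg_min_on (\<lambda>x. v (\<tau> x) x) A"])
      (use arg_min_if_finite[OF fin, of "\<lambda>x. v (\<tau> x) x"] \<open>a \<in> A\<close> in \<open>auto simp: not_less\<close>)
  define t where "t = \<tau> b"
  have min: "v t b \<le> v s x" if "x \<in> A" "s \<in> {0..T}" for x s
    using b(2)[OF that(1)] \<tau>(2)[OF that] by (simp add: t_def)
  have t: "0 \<le> t" "t \<le> T" using \<tau>(1)[OF b(1)] by (auto simp: t_def)
  have vneg: "v t b < 0"
    using min[OF \<open>a \<in> A\<close>, of T] neg' \<open>T \<ge> 0\<close> by (simp add: v_def)
  have "t \<noteq> 0"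
    using vneg init[OF b(1)] by (auto simp: v_def)
  then have "t > 0" using t by simp
  then obtain d where d: "((\<lambda>s. u s b) has_real_derivative d) (at t)" "0 \<le> laplacian E (u t) b + d"
    using super b(1) by blast
  have "((\<lambda>s. v s b) has_real_derivative d + \<epsilon>) (at t)"
    unfolding v_def by (auto intro!: derivative_eq_intros d)
  \<comment> \<open>Only earlier times are compared, since the minimum may sit at the end point
    \<open>t = T\<close>.\<close>
  moreover have "\<exists>h>0. h < e \<and> \<not> v (t - h) b < v t b" if "e > 0" for e
  proof -
    obtain h where "0 < h" "h < min e t"
      using \<open>e > 0\<close> \<open>t > 0\<close> dense[of 0 "min e t"] by auto
    then show ?thesis
      using min[OF b(1), of "t - h"] t by (intro exI[of _ h]) auto
  qed
  ultimately have "d + \<epsilon> \<le> 0"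
    using DERIV_pos_inc_left[of "\<lambda>s. v s b" "d + \<epsilon>" t] by (meson not_le)
  moreover have "laplacian E (u t) b \<le> 0"
    unfolding laplacian_def
  proof (intro sum_nonpos)
    fix y assume "y \<in> E `` {b}"
    show "u t b - u t y \<le> 0"
    proof (cases "y \<in> A")
      case True
      then show ?thesis using min[OF True, of t] t by (simp add: v_def)
    next
      \<comment> \<open>A neighbor outside \<open>A\<close> has a nonnegative value by
        \<open>bdry\<close>, whereas \<open>u t b\<close> is negative.\<close>
      case False
      moreover have "0 \<le> \<epsilon> * t" using \<open>\<epsilon> > 0\<close> t by simp
      moreover from this have "u t b < 0" using vneg unfolding v_def by linarith
      ultimately show ?thesis
        using bdry[of t b y] b(1) t \<open>y \<in> E `` {b}\<close> by simp
    qed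
  qed
  ultimately show False using d(2) \<open>\<epsilon> > 0\<close> by simp
qed

section \<open>Consequences of the minimum principle\<close>

lemma dirichlet_heat_kernel_nonneg:
  assumes "finite W" "t \<ge> 0"
  shows "0 \<le> dirichlet_heat_kernel E W t x y"
proof (cases "x \<in> graph_interior E W")
  case True
  show ?thesis
  proof (rule minimum_principle[where A="graph_interior E W" and u="\<lambda>t x. dirichlet_heat_kernel E W t x y"])
    fix t :: real and x assume "x \<in> graph_interior E W"
    then show "\<exists>d. ((\<lambda>s. dirichlet_heat_kernel E W s x y) has_real_derivative d) (at t) \<and>
        0 \<le> laplacian E (\<lambda>x. dirichlet_heat_kernel E W t x y) x + d"
      using dirichlet_heat_kernel_deriv[OF assms(1)] by (metis add.right_inverse order.refl)
  qed (use assms True in \<open>auto simp: finite_graph_interior dirichlet_heat_kernel_continuous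
    dirichlet_heat_kernel_0 dirichlet_heat_kernel_outside_left\<close>)
qed (simp add: assms dirichlet_heat_kernel_outside_left)

text \<open>The minimum principle applied to \<open>w\<close> minus the kernel: the two heat
  equations cancel on the interior, and off it the kernel is 0, so nonnegativity of \<open>w\<close>
  at adjacent vertices is enough.\<close>

lemma dirichlet_heat_kernel_minimal:
  fixes w :: "real \<Rightarrow> 'v \<Rightarrow> real"
  assumes fin: "finite W"
    and cont: "\<And>x. x \<in> graph_interior E W \<Longrightarrow> continuous_on {0..} (\<lambda>t. w t x)"
    and heat: "\<And>t x. t > 0 \<Longrightarrow> x \<in> graph_interior E W \<Longrightarrow>
      \<exists>d. ((\<lambda>s. w s x) has_real_derivative d) (at t) \<and> laplacian E (w t) x + d = 0"
    and init: "\<And>x. x \<in> graph_interior E W \<Longrightarrow> (if x = y then 1 else 0) \<le> w 0 x"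
    and nonneg: "\<And>t x z. t \<ge> 0 \<Longrightarrow> x \<in> graph_interior E W \<Longrightarrow> (x, z) \<in> E \<Longrightarrow> 0 \<le> w t z"
    and "t \<ge> 0" "x \<in> graph_interior E W"
  shows "dirichlet_heat_kernel E W t x y \<le> w t x"
proof -
  have "0 \<le> w t x - dirichlet_heat_kernel E W t x y"
  proof (rule minimum_principle[where A="graph_interior E W" and u="\<lambda>t x. w t x - dirichlet_heat_kernel E W t x y"])
    fix t :: real and x assume "t > 0" "x \<in> graph_interior E W"
    then obtain d where d: "((\<lambda>s. w s x) has_real_derivative d) (at t)" "laplacian E (w t) x + d = 0"
      using heat by blast
    have "((\<lambda>s. w s x - dirichlet_heat_kernel E W s x y) has_real_derivative
        d - (- laplacian E (\<lambda>x. dirichlet_heat_kernel E W t x y) x)) (at t)"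
      using \<open>x \<in> graph_interior E W\<close> by (intro DERIV_diff d dirichlet_heat_kernel_deriv fin)
    with d(2) show "\<exists>d. ((\<lambda>s. w s x - dirichlet_heat_kernel E W s x y) has_real_derivative d) (at t) \<and>
        0 \<le> laplacian E (\<lambda>x. w t x - dirichlet_heat_kernel E W t x y) x + d"
      unfolding laplacian_diff by force
  next
    fix x assume "x \<in> graph_interior E W"
    then show "0 \<le> w 0 x - dirichlet_heat_kernel E W 0 x y"
      using init[of x] by (simp add: dirichlet_heat_kernel_0[OF fin])
  qed (use assms in \<open>auto simp: finite_graph_interior dirichlet_heat_kernel_continuous
    dirichlet_heat_kernel_outside_left intro!: continuous_on_diff\<close>)
  then show ?thesis by simp
qed

text \<open>On the smaller interior the kernel of \<open>W'\<close> is itself a nonnegative solution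
  with the same initial value, hence a competitor in
  \<open>dirichlet_heat_kernel_minimal\<close>.\<close>

lemma dirichlet_heat_kernel_mono:
  assumes "finite W" "finite W'" "graph_interior E W \<subseteq> graph_interior E W'" "t \<ge> 0"
  shows "dirichlet_heat_kernel E W t x y \<le> dirichlet_heat_kernel E W' t x y"
proof (cases "x \<in> graph_interior E W")
  case True
  show ?thesis
  proof (rule dirichlet_heat_kernel_minimal)
    fix t :: real and x assume "x \<in> graph_interior E W"
    then show "\<exists>d. ((\<lambda>s. dirichlet_heat_kernel E W' s x y) has_real_derivative d) (at t) \<and>
        laplacian E (\<lambda>x. dirichlet_heat_kernel E W' t x y) x + d = 0"
      using dirichlet_heat_kernel_deriv[OF assms(2)] assms(3) by (meson add.right_inverse subset_iff)
  qed (use assms True in \<open>auto simp: dirichlet_heat_kernel_continuous dirichlet_heat_kernel_nonneg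
    dirichlet_heat_kernel_0 subset_iff\<close>)
qed (simp add: assms dirichlet_heat_kernel_outside_left dirichlet_heat_kernel_nonneg)

text \<open>One minus the partial row sum solves the heat equation on the interior, is 0 or 1 there
  at time 0, and equals 1 off the interior.\<close>

lemma dirichlet_heat_kernel_sum_le_1:
  assumes "finite W" "t \<ge> 0" "finite S"
  shows "(\<Sum>y\<in>S. dirichlet_heat_kernel E W t x y) \<le> 1"
proof (cases "x \<in> graph_interior E W")
  case True
  \<comment> \<open>The factor \<open>1 *\<close> gives the sum the shape required by
    \<open>laplacian_sum\<close>.\<close>
  let ?u = "\<lambda>t x. 1 - (\<Sum>y\<in>S. 1 * dirichlet_heat_kernel E W t x y)"
  have "0 \<le> ?u t x"
  proof (rule minimum_principle[where A="graph_interior E W" and u="?u"])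
    fix t :: real and x assume x: "x \<in> graph_interior E W"
    have "((\<lambda>s. ?u s x) has_real_derivative
        0 - (\<Sum>y\<in>S. 1 * - laplacian E (\<lambda>z. dirichlet_heat_kernel E W t z y) x)) (at t)"
      using x by (intro DERIV_diff[OF DERIV_const] DERIV_sum DERIV_cmult dirichlet_heat_kernel_deriv assms)
    then show "\<exists>d. ((\<lambda>s. ?u s x) has_real_derivative d) (at t) \<and>
        0 \<le> laplacian E (?u t) x + d"
      unfolding laplacian_diff laplacian_sum laplacian_const
      by (intro exI conjI) (assumption, simp add: sum_negf)
  next
    fix x assume x: "x \<in> graph_interior E W"
    show "0 \<le> ?u 0 x"
      using assms by (simp add: dirichlet_heat_kernel_0[OF assms(1) x])
  qed (use assms True in \<open>auto simp: finite_graph_interior dirichlet_heat_kernel_continuous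
    dirichlet_heat_kernel_outside_left intro!: continuous_intros\<close>)
  then show ?thesis by simp
qed (simp add: assms dirichlet_heat_kernel_outside_left)

lemma dirichlet_heat_kernel_le_1:
  assumes "finite W" "t \<ge> 0"
  shows "dirichlet_heat_kernel E W t x y \<le> 1"
  using dirichlet_heat_kernel_sum_le_1[OF assms, of "{y}" x] by simp

end


section \<open>The limit along an exhaustion\<close>

lemma deriv_laplacian:
  assumes "\<And>z. z \<in> insert x (E `` {x}) \<Longrightarrow> ((\<lambda>s. f s z) has_real_derivative g z) (at t within S)"
  shows "((\<lambda>s. laplacian E (f s) x) has_real_derivative laplacian E g x) (at t within S)"
  unfolding laplacian_def using assms by (intro DERIV_sum DERIV_diff) auto

lemma continuous_on_laplacian:
  assumes "\<And>z. z \<in> insert x (E `` {x}) \<Longrightarrow> continuous_on S (\<lambda>s. f s z)"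
  shows "continuous_on S (\<lambda>s. laplacian E (f s) x)"
  unfolding laplacian_def using assms by (intro continuous_on_sum continuous_on_diff) auto

lemma tendsto_laplacian:
  assumes "\<And>z. z \<in> insert x (E `` {x}) \<Longrightarrow> ((\<lambda>n. f n z) \<longlongrightarrow> g z) F"
  shows "((\<lambda>n. laplacian E (f n) x) \<longlongrightarrow> laplacian E g x) F"
  unfolding laplacian_def using assms by (intro tendsto_sum tendsto_diff) auto

text \<open>Covers both the balls and the members of a \<open>graph_exhaustion\<close>. Only vertex
  sets are recorded because the Dirichlet kernel is determined by them and \<open>E\<close>.\<close>

locale network_exhaustion = locally_finite_network E for E :: "'v rel" +
  fixes V :: "'v set" and W :: "nat \<Rightarrow> 'v set"
  assumes E_subset: "E \<subseteq> V \<times> V"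
    and finite_W: "finite (W n)"
    and W_Suc: "W n \<subseteq> W (Suc n)"
    and UN_W: "(\<Union>n. W n) = V"
begin

section \<open>Absorption of finite sets by the exhaustion\<close>

lemma W_mono: "m \<le> n \<Longrightarrow> W m \<subseteq> W n"
  by (rule lift_Suc_mono_le[of W]) (rule W_Suc)

lemma graph_interior_mono: "A \<subseteq> B \<Longrightarrow> graph_interior E A \<subseteq> graph_interior E B"
  by (auto simp: graph_interior_def graph_boundary_def)

lemma finite_subset_W:
  assumes "finite S" "S \<subseteq> V"
  shows "\<exists>n. S \<subseteq> W n"
  using assms
proof (induction S)
  case (insert x S)
  then obtain m n where "S \<subseteq> W m" "x \<in> W n"
    using UN_W by auto
  then have "insert x S \<subseteq> W (max m n)"
    using W_mono[of m "max m n"] W_mono[of n "max m n"] by auto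
  then show ?case ..
qed simp

text \<open>Once \<open>W n\<close> contains \<open>S\<close> together with its finitely many
  neighbors, no edge from \<open>S\<close> leaves \<open>W n\<close>.\<close>

lemma finite_subset_interior:
  assumes "finite S" "S \<subseteq> V"
  shows "\<exists>n. S \<subseteq> graph_interior E (W n)"
proof -
  have "finite (S \<union> E `` S)"
    using assms finite_neighbors by (simp add: Image_eq_UN[of E S])
  moreover have "S \<union> E `` S \<subseteq> V"
    using assms E_subset by auto
  ultimately obtain n where "S \<union> E `` S \<subseteq> W n"
    using finite_subset_W by blast
  then have "S \<subseteq> graph_interior E (W n)"
    by (auto simp: graph_interior_def graph_boundary_def)
  then show ?thesis ..
qed

lemma eventually_interior:
  assumes "x \<in> V"
  shows "\<forall>\<^sub>F n in sequentially. x \<in> graph_interior E (W n)"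
proof -
  obtain N where "x \<in> graph_interior E (W N)"
    using finite_subset_interior[of "{x}"] assms by auto
  then show ?thesis
    using graph_interior_mono[OF W_mono] by (auto simp: eventually_sequentially)
qed

section \<open>The limit kernel: convergence, mass, semigroup law and minimality\<close>

definition limit_kernel :: "real \<Rightarrow> 'v \<Rightarrow> 'v \<Rightarrow> real" where
  "limit_kernel t x y = lim (\<lambda>n. dirichlet_heat_kernel E (W n) t x y)"

lemma incseq_kernel:
  "t \<ge> 0 \<Longrightarrow> incseq (\<lambda>n. dirichlet_heat_kernel E (W n) t x y)"
  unfolding incseq_def
  by (intro allI impI dirichlet_heat_kernel_mono finite_W graph_interior_mono W_mono)

lemma limit_kernel_LIMSEQ:
  assumes "t \<ge> 0"
  shows "(\<lambda>n. dirichlet_heat_kernel E (W n) t x y) \<longlonglongrightarrow> limit_kernel t x y"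
proof -
  have "\<forall>n. dirichlet_heat_kernel E (W n) t x y \<le> 1"
    using dirichlet_heat_kernel_le_1 finite_W assms by blast
  then obtain L where "(\<lambda>n. dirichlet_heat_kernel E (W n) t x y) \<longlonglongrightarrow> L"
    using incseq_convergent[OF incseq_kernel[OF assms]] by metis
  then show ?thesis
    unfolding limit_kernel_def by (simp add: limI)
qed

lemma kernel_le_limit_kernel:
  "t \<ge> 0 \<Longrightarrow> dirichlet_heat_kernel E (W n) t x y \<le> limit_kernel t x y"
  by (rule incseq_le[OF incseq_kernel limit_kernel_LIMSEQ])

text \<open>\<open>U\<close> may be unrelated to the sequence; its interior still lies in that of
  some \<open>W n\<close>. This lets one exhaustion dominate another.\<close>

lemma dirichlet_heat_kernel_le_limit_kernel:
  assumes "finite U" "U \<subseteq> V" "t \<ge> 0"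
  shows "dirichlet_heat_kernel E U t x y \<le> limit_kernel t x y"
proof -
  obtain n where "U \<subseteq> graph_interior E (W n)"
    using finite_subset_interior assms by blast
  then have "graph_interior E U \<subseteq> graph_interior E (W n)"
    using graph_interior_subset by blast
  then show ?thesis
    using dirichlet_heat_kernel_mono[OF assms(1) finite_W _ assms(3)] kernel_le_limit_kernel[OF assms(3)]
    by (meson order.trans)
qed

lemma limit_kernel_commute: "t \<ge> 0 \<Longrightarrow> limit_kernel t x y = limit_kernel t y x"
  unfolding limit_kernel_def by (simp add: dirichlet_heat_kernel_commute[OF finite_W, of _ t x y])

lemma limit_kernel_nonneg: "t \<ge> 0 \<Longrightarrow> 0 \<le> limit_kernel t x y"
  using kernel_le_limit_kernel dirichlet_heat_kernel_nonneg[OF finite_W] by (meson order.trans)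

lemma limit_kernel_0:
  assumes "x \<in> V"
  shows "limit_kernel 0 x y = (if x = y then 1 else 0)"
proof (rule LIMSEQ_unique[OF limit_kernel_LIMSEQ])
  show "(\<lambda>n. dirichlet_heat_kernel E (W n) 0 x y) \<longlonglongrightarrow> (if x = y then 1 else 0)"
    using eventually_interior[OF assms]
    by (intro tendsto_eventually) (auto elim!: eventually_mono simp: dirichlet_heat_kernel_0 finite_W)
qed simp

lemma limit_kernel_sum_le_1:
  assumes "t \<ge> 0" "finite S"
  shows "(\<Sum>y\<in>S. limit_kernel t x y) \<le> 1"
proof (rule LIMSEQ_le_const2)
  show "(\<lambda>n. \<Sum>y\<in>S. dirichlet_heat_kernel E (W n) t x y) \<longlonglongrightarrow> (\<Sum>y\<in>S. limit_kernel t x y)"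
    by (intro tendsto_sum limit_kernel_LIMSEQ assms)
qed (use dirichlet_heat_kernel_sum_le_1[OF finite_W assms] in blast)

lemma limit_kernel_summable:
  assumes "t \<ge> 0"
  shows "(\<lambda>y. limit_kernel t x y) summable_on S" "(\<Sum>\<^sub>\<infinity>y\<in>S. limit_kernel t x y) \<le> 1"
proof -
  show summable: "(\<lambda>y. limit_kernel t x y) summable_on S"
    by (intro nonneg_bdd_above_summable_on bdd_aboveI2[of _ _ 1] limit_kernel_nonneg assms)
      (auto intro: limit_kernel_sum_le_1 assms)
  show "(\<Sum>\<^sub>\<infinity>y\<in>S. limit_kernel t x y) \<le> 1"
    by (intro infsum_le_finite_sums summable limit_kernel_sum_le_1 assms)
qed

text \<open>Two limits of the finite identity. Over a fixed finite \<open>S\<close> its left side is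
  a partial sum, which bounds every finite sum from above; conversely, replacing both factors by
  their limits bounds each finite kernel by the infinite sum.\<close>

lemma limit_kernel_semigroup:
  assumes "s \<ge> 0" "t \<ge> 0"
  shows "((\<lambda>z. limit_kernel s x z * limit_kernel t z y) has_sum limit_kernel (s + t) x y) V"
proof -
  let ?f = "\<lambda>z. limit_kernel s x z * limit_kernel t z y"
  let ?K = "\<lambda>n. dirichlet_heat_kernel E (W n)"
  have nonneg: "0 \<le> ?f z" for z
    using assms by (simp add: limit_kernel_nonneg)
  have upper: "sum ?f S \<le> limit_kernel (s + t) x y" if "finite S" "S \<subseteq> V" for S
  proof (rule LIMSEQ_le)
    show "(\<lambda>n. \<Sum>z\<in>S. ?K n s x z * ?K n t z y) \<longlonglongrightarrow> sum ?f S"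
      by (intro tendsto_sum tendsto_mult limit_kernel_LIMSEQ assms)
    show "(\<lambda>n. ?K n (s + t) x y) \<longlonglongrightarrow> limit_kernel (s + t) x y"
      using assms by (intro limit_kernel_LIMSEQ) simp
    obtain N where "S \<subseteq> W N"
      using finite_subset_W \<open>finite S\<close> \<open>S \<subseteq> V\<close> by blast
    have "(\<Sum>z\<in>S. ?K n s x z * ?K n t z y) \<le> ?K n (s + t) x y" if "n \<ge> N" for n
      unfolding dirichlet_heat_kernel_semigroup[OF finite_W, symmetric]
      using \<open>S \<subseteq> W N\<close> W_mono[OF that] assms
      by (intro sum_mono2 finite_W mult_nonneg_nonneg dirichlet_heat_kernel_nonneg) auto
    then show "\<exists>N. \<forall>n\<ge>N. (\<Sum>z\<in>S. ?K n s x z * ?K n t z y) \<le> ?K n (s + t) x y"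
      by blast
  qed
  have summable: "?f summable_on V"
    using upper by (intro nonneg_bdd_above_summable_on bdd_aboveI2[of _ _ "limit_kernel (s + t) x y"] nonneg) auto
  have "limit_kernel (s + t) x y \<le> infsum ?f V"
  proof (rule LIMSEQ_le_const2)
    show "(\<lambda>n. ?K n (s + t) x y) \<longlonglongrightarrow> limit_kernel (s + t) x y"
      using assms by (intro limit_kernel_LIMSEQ) simp
    have "?K n (s + t) x y \<le> infsum ?f V" for n
    proof -
      have "?K n (s + t) x y \<le> sum ?f (W n)"
        unfolding dirichlet_heat_kernel_semigroup[OF finite_W, symmetric] using assms
        by (intro sum_mono mult_mono kernel_le_limit_kernel dirichlet_heat_kernel_nonneg finite_W limit_kernel_nonneg)
      also have "\<dots> \<le> infsum ?f V"
        using UN_W by (intro finite_sum_le_infsum summable finite_W nonneg) auto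
      finally show ?thesis .
    qed
    then show "\<exists>N. \<forall>n\<ge>N. ?K n (s + t) x y \<le> infsum ?f V"
      by blast
  qed
  then have "infsum ?f V = limit_kernel (s + t) x y"
    by (intro antisym infsum_le_finite_sums summable upper)
  then show ?thesis
    using has_sum_infsum[OF summable] by simp
qed

text \<open>\<open>w\<close> dominates every finite kernel: by comparison inside the interior, by
  nonnegativity outside. Taking a function of one vertex with \<open>y\<close> as a parameter lets
  the lemma serve competitors solving the equation in either variable.\<close>

lemma limit_kernel_minimal:
  fixes w :: "real \<Rightarrow> 'v \<Rightarrow> real"
  assumes cont: "\<And>x. x \<in> V \<Longrightarrow> continuous_on {0..} (\<lambda>t. w t x)"
    and heat: "\<And>t x. t > 0 \<Longrightarrow> x \<in> V \<Longrightarrow>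
      \<exists>d. ((\<lambda>s. w s x) has_real_derivative d) (at t) \<and> laplacian E (w t) x + d = 0"
    and init: "\<And>x. x \<in> V \<Longrightarrow> w 0 x = (if x = y then 1 else 0)"
    and nonneg: "\<And>t x. t \<ge> 0 \<Longrightarrow> x \<in> V \<Longrightarrow> 0 \<le> w t x"
    and "t \<ge> 0" "x \<in> V"
  shows "limit_kernel t x y \<le> w t x"
proof (rule LIMSEQ_le_const2[OF limit_kernel_LIMSEQ[OF \<open>t \<ge> 0\<close>]])
  have sub: "z \<in> V" if "z \<in> graph_interior E (W n)" for n z
    using that graph_interior_subset UN_W by blast
  have "dirichlet_heat_kernel E (W n) t x y \<le> w t x" for n
  proof (cases "x \<in> graph_interior E (W n)")
    case True
    show ?thesis
      by (rule dirichlet_heat_kernel_minimal)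
        (use True sub E_subset finite_W assms in auto)
  next
    case False
    then show ?thesis
      by (simp add: dirichlet_heat_kernel_outside_left finite_W nonneg assms)
  qed
  then show "\<exists>N. \<forall>n\<ge>N. dirichlet_heat_kernel E (W n) t x y \<le> w t x"
    by blast
qed

text \<open>Pointwise convergence says nothing about derivatives, so the integrated equation is
  passed to the limit. Kernel values lie in \<open>[0, 1]\<close>, hence the degree of
  \<open>x\<close> dominates the integrands.\<close>

lemma limit_kernel_integral:
  assumes "x \<in> V" "t \<ge> 0"
  shows "(\<lambda>s. laplacian E (\<lambda>z. limit_kernel s z y) x) integrable_on {0..t}"
    and "limit_kernel t x y = limit_kernel 0 x y -
      integral {0..t} (\<lambda>s. laplacian E (\<lambda>z. limit_kernel s z y) x)"
proof -
  obtain N where N: "x \<in> graph_interior E (W N)"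
    using finite_subset_interior[of "{x}"] assms by auto
  \<comment> \<open>The shift by \<open>N\<close> puts \<open>x\<close> in the interior for every
    index, so the heat equation at \<open>x\<close> holds along the whole sequence.\<close>
  define k where "k n = dirichlet_heat_kernel E (W (n + N))" for n
  define g where "g n s = laplacian E (\<lambda>z. k n s z y) x" for n s
  have x_int: "x \<in> graph_interior E (W (n + N))" for n
    using N graph_interior_mono[OF W_mono[of N "n + N"]] by auto
  have lim: "(\<lambda>n. k n s z y) \<longlonglongrightarrow> limit_kernel s z y" if "s \<ge> 0" for s z
    unfolding k_def using limit_kernel_LIMSEQ[OF that] by (rule LIMSEQ_ignore_initial_segment)
  have "(g n has_integral (- k n t x y - - k n 0 x y)) {0..t}" for n
    using dirichlet_heat_kernel_deriv[OF finite_W x_int, THEN DERIV_minus] \<open>t \<ge> 0\<close>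
    unfolding g_def k_def
    by (intro fundamental_theorem_of_calculus)
      (auto simp: has_real_derivative_iff_has_vector_derivative[symmetric])
  then have int: "(g n has_integral (k n 0 x y - k n t x y)) {0..t}" for n
    by simp
  have bound: "norm (g n s) \<le> real (card (E `` {x}))" if "s \<in> {0..t}" for n s
  proof -
    have "\<bar>g n s\<bar> \<le> (\<Sum>z\<in>E `` {x}. \<bar>k n s x y - k n s z y\<bar>)"
      unfolding g_def laplacian_def by (rule sum_abs)
    also have "\<dots> \<le> (\<Sum>z\<in>E `` {x}. 1)"
    proof (rule sum_mono)
      fix z
      have "0 \<le> k n s v y" "k n s v y \<le> 1" for v
        using that unfolding k_def
        by (auto intro: dirichlet_heat_kernel_nonneg dirichlet_heat_kernel_le_1 finite_W)
      then show "\<bar>k n s x y - k n s z y\<bar> \<le> 1"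
        by (smt (verit))
    qed
    finally show ?thesis by simp
  qed
  have conv: "(\<lambda>n. g n s) \<longlonglongrightarrow> laplacian E (\<lambda>z. limit_kernel s z y) x" if "s \<in> {0..t}" for s
    unfolding g_def using that by (intro tendsto_laplacian lim) auto
  note dom = dominated_convergence[where f=g and S="{0..t}" and h="\<lambda>_. real (card (E `` {x}))",
      OF has_integral_integrable[OF int] integrable_const_ivl bound conv]
  show "(\<lambda>s. laplacian E (\<lambda>z. limit_kernel s z y) x) integrable_on {0..t}"
    by (rule dom)
  have "(\<lambda>n. k n 0 x y - k n t x y) \<longlonglongrightarrow> integral {0..t} (\<lambda>s. laplacian E (\<lambda>z. limit_kernel s z y) x)"
    using dom(2) by (simp add: integral_unique[OF int])
  moreover have "(\<lambda>n. k n 0 x y - k n t x y) \<longlonglongrightarrow> limit_kernel 0 x y - limit_kernel t x y"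
    using assms by (intro tendsto_diff lim) auto
  ultimately show "limit_kernel t x y = limit_kernel 0 x y -
      integral {0..t} (\<lambda>s. laplacian E (\<lambda>z. limit_kernel s z y) x)"
    using LIMSEQ_unique by fastforce
qed

section \<open>Differentiability in time and strict positivity\<close>

lemma neighbor_in_V: "x \<in> V \<Longrightarrow> z \<in> insert x (E `` {x}) \<Longrightarrow> z \<in> V"
  using E_subset by auto

text \<open>A bootstrap: the integral formula makes the kernel continuous in time at every vertex,
  so the integrand, a finite sum, is continuous, and the fundamental theorem differentiates the
  formula.\<close>

lemma limit_kernel_deriv:
  assumes "x \<in> V" "t \<ge> 0"
  shows "((\<lambda>s. limit_kernel s x y) has_real_derivative
    - laplacian E (\<lambda>z. limit_kernel t z y) x) (at t within {0..})"
proof -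
  let ?G = "\<lambda>x s. laplacian E (\<lambda>z. limit_kernel s z y) x"
  have cont: "continuous_on {0..t+1} (\<lambda>s. limit_kernel s z y)" if "z \<in> V" for z
  proof -
    have "continuous_on {0..t+1} (\<lambda>s. limit_kernel 0 z y - integral {0..s} (?G z))"
      using limit_kernel_integral(1)[OF that, of "t + 1" y] \<open>t \<ge> 0\<close>
      by (intro continuous_intros indefinite_integral_continuous_1) auto
    then show ?thesis
      by (rule continuous_on_eq) (use limit_kernel_integral(2)[OF that, of _ y, symmetric] in simp)
  qed
  have "continuous_on {0..t+1} (?G x)"
    by (intro continuous_on_laplacian cont neighbor_in_V[OF assms(1)])
  then have "((\<lambda>s. limit_kernel 0 x y - integral {0..s} (?G x)) has_real_derivative
      0 - ?G x t) (at t within {0..t+1})"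
    using assms by (intro DERIV_diff[OF DERIV_const] integral_has_real_derivative) auto
  then have "((\<lambda>s. limit_kernel 0 x y - integral {0..s} (?G x)) has_real_derivative
      - ?G x t) (at t within {0..t+1})"
    by simp
  then have "((\<lambda>s. limit_kernel s x y) has_real_derivative - ?G x t) (at t within {0..t+1})"
    by (rule has_field_derivative_transform_within[OF _ zero_less_one])
      (use assms limit_kernel_integral(2)[OF \<open>x \<in> V\<close>, of _ y, symmetric] in auto)
  \<comment> \<open>The end point \<open>t + 1\<close> leaves room to the right of \<open>t\<close>;
    at \<open>t = 0\<close> the derivative stays one-sided.\<close>
  moreover have "at t within {0..t+1} = at t within {0..}"
    using assms by (intro at_within_nhd[of t "{..<t+1}"]) auto
  ultimately show ?thesis by simp
qed

lemma limit_kernel_continuous: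
  assumes "x \<in> V"
  shows "continuous_on {0..} (\<lambda>t. limit_kernel t x y)"
  using limit_kernel_deriv[OF assms]
  by (auto simp: continuous_on_eq_continuous_within intro: DERIV_continuous)

lemma limit_kernel_deriv_at:
  assumes "x \<in> V" "t > 0"
  shows "((\<lambda>s. limit_kernel s x y) has_real_derivative
    - laplacian E (\<lambda>z. limit_kernel t z y) x) (at t)"
proof -
  have "at t within {0..} = at t"
    using assms by (intro at_within_interior) auto
  then show ?thesis
    using limit_kernel_deriv[of x t y] assms by simp
qed

text \<open>The \<open>k\<close>-th time derivative is the \<open>k\<close>-th power of minus the
  Laplacian, applied in the first variable. The induction treats all vertices at once because its
  step uses the neighbors of \<open>x\<close>.\<close>

lemma limit_kernel_smooth:
  assumes "x \<in> V"
  shows "smooth_on_halfline (\<lambda>t. limit_kernel t x y)"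
proof -
  define D where "D k t = ((\<lambda>f x. - laplacian E f x) ^^ k) (\<lambda>z. limit_kernel t z y)" for k t
  have "((\<lambda>s. D k s x) has_real_derivative D (Suc k) t x) (at t within {0..})"
    if "t \<ge> 0" "x \<in> V" for k t x
    using that(2)
  proof (induction k arbitrary: x)
    case 0
    then show ?case
      using limit_kernel_deriv[OF _ \<open>t \<ge> 0\<close>] by (simp add: D_def)
  next
    case (Suc k)
    have "((\<lambda>s. - laplacian E (D k s) x) has_real_derivative
        - laplacian E (D (Suc k) t) x) (at t within {0..})"
      using Suc.IH neighbor_in_V[OF Suc.prems] by (intro DERIV_minus deriv_laplacian) simp
    then show ?case by (simp add: D_def)
  qed
  then show ?thesis
    unfolding smooth_on_halfline_def using assms
    by (intro exI[of _ "\<lambda>k t. D k t x"]) (simp add: D_def)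
qed

text \<open>
  The integrating factor absorbs the diagonal part of the Laplacian, so that \<open>e\<^bsup>deg(x) t\<^esup> p\<^sub>t(x, y)\<close> has
  a nonnegative derivative.
\<close>

lemma limit_kernel_exp_deriv:
  assumes "x \<in> V" "t > 0"
  shows "((\<lambda>s. exp (real (card (E `` {x})) * s) * limit_kernel s x y) has_real_derivative
    exp (real (card (E `` {x})) * t) * (\<Sum>z\<in>E `` {x}. limit_kernel t z y)) (at t)"
proof -
  have sum_eq: "(\<Sum>z\<in>E `` {x}. limit_kernel t z y) =
      real (card (E `` {x})) * limit_kernel t x y - laplacian E (\<lambda>z. limit_kernel t z y) x"
    by (simp add: laplacian_def sum_subtractf)
  then show ?thesis
    using limit_kernel_deriv_at[OF assms, of y]
    by (auto intro!: derivative_eq_intros simp: sum_eq algebra_simps)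
qed

lemma limit_kernel_exp_mono:
  assumes "x \<in> V" "0 \<le> s" "s \<le> t"
  shows "exp (real (card (E `` {x})) * s) * limit_kernel s x y \<le> exp (real (card (E `` {x})) * t) * limit_kernel t x y"
proof (rule DERIV_nonneg_imp_increasing_open[OF \<open>s \<le> t\<close>])
  fix r assume "s < r" "r < t"
  show "\<exists>d. ((\<lambda>s. exp (real (card (E `` {x})) * s) * limit_kernel s x y) has_real_derivative d) (at r) \<and> 0 \<le> d"
  proof (intro exI conjI)
    show "((\<lambda>s. exp (real (card (E `` {x})) * s) * limit_kernel s x y) has_real_derivative
        exp (real (card (E `` {x})) * r) * (\<Sum>z\<in>E `` {x}. limit_kernel r z y)) (at r)"
      using \<open>s < r\<close> assms by (intro limit_kernel_exp_deriv) auto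
    show "0 \<le> exp (real (card (E `` {x})) * r) * (\<Sum>z\<in>E `` {x}. limit_kernel r z y)"
      using \<open>s < r\<close> assms by (intro mult_nonneg_nonneg sum_nonneg limit_kernel_nonneg) auto
  qed
qed (use assms in \<open>auto intro!: continuous_intros continuous_on_subset[OF limit_kernel_continuous]\<close>)

text \<open>
  If \<open>p\<^sub>t(x, y)\<close> vanished, monotonicity would make it vanish on \<open>(0, t)\<close>, and then its derivative
  would force \<open>p(z, y)\<close> to vanish at every neighbor \<open>z\<close> of \<open>x\<close>: positivity spreads along edges.
\<close>

lemma limit_kernel_pos:
  assumes "(x, y) \<in> E\<^sup>*" "y \<in> V" "t > 0"
  shows "0 < limit_kernel t x y"
  using assms(1,3)
proof (induction arbitrary: t rule: converse_rtrancl_induct)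
  case base
  have "0 < exp (real (card (E `` {y})) * 0) * limit_kernel 0 y y"
    using \<open>y \<in> V\<close> by (simp add: limit_kernel_0)
  also have "\<dots> \<le> exp (real (card (E `` {y})) * t) * limit_kernel t y y"
    using \<open>y \<in> V\<close> base by (intro limit_kernel_exp_mono) auto
  finally show ?case by (simp add: zero_less_mult_iff)
next
  case (step x z)
  have "x \<in> V" using step E_subset by auto
  define g where "g s = exp (real (card (E `` {x})) * s) * limit_kernel s x y" for s
  show ?case
  proof (rule ccontr)
    assume "\<not> 0 < limit_kernel t x y"
    then have "g t = 0"
      using limit_kernel_nonneg[of t x y] step by (simp add: g_def)
    have zero: "g s = 0" if "s \<in> {0<..<t}" for s
    proof (rule antisym)
      show "g s \<le> 0"
        using limit_kernel_exp_mono[OF \<open>x \<in> V\<close>, of s t y] that \<open>g t = 0\<close> unfolding g_def by simp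
      show "0 \<le> g s"
        using limit_kernel_nonneg[of s x y] that by (simp add: g_def)
    qed
    have deriv0: "(g has_real_derivative 0) (at (t/2))"
    proof (rule has_field_derivative_transform_within_open[where f="\<lambda>_. 0"])
      show "open {0<..<t}" "t / 2 \<in> {0<..<t}"
        using step by auto
    qed (auto simp: zero)
    have deriv: "(g has_real_derivative
        exp (real (card (E `` {x})) * (t/2)) * (\<Sum>z\<in>E `` {x}. limit_kernel (t/2) z y)) (at (t/2))"
      unfolding g_def using step \<open>x \<in> V\<close> by (intro limit_kernel_exp_deriv) auto
    have "(\<Sum>z\<in>E `` {x}. limit_kernel (t/2) z y) = 0"
      using DERIV_unique[OF deriv0 deriv] by simp
    \<comment> \<open>The induction hypothesis is used at time \<open>t/2\<close> for the neighbor
      \<open>z\<close>, which is why \<open>t\<close> is kept arbitrary.\<close>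
    moreover have "0 < (\<Sum>z\<in>E `` {x}. limit_kernel (t/2) z y)"
      using step finite_neighbors by (intro sum_pos2[of _ z] limit_kernel_nonneg) auto
    ultimately show False by simp
  qed
qed

end

text \<open>Each member of one exhaustion is a finite subset of \<open>V\<close>, so its kernel lies
  below the limit along the other; exchanging the roles gives equality.\<close>

lemma limit_kernel_unique:
  assumes "network_exhaustion E V W" "network_exhaustion E V W'" "t \<ge> 0"
  shows "network_exhaustion.limit_kernel E W t x y = network_exhaustion.limit_kernel E W' t x y"
proof -
  have "network_exhaustion.limit_kernel E U t x y \<le> network_exhaustion.limit_kernel E U' t x y"
    if "network_exhaustion E V U" "network_exhaustion E V U'" for U U'
  proof -
    interpret U: network_exhaustion E V U by fact
    interpret U': network_exhaustion E V U' by fact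
    have "U n \<subseteq> V" for n
      using U.UN_W by blast
    then show ?thesis
      using U'.dirichlet_heat_kernel_le_limit_kernel[OF U.finite_W _ \<open>t \<ge> 0\<close>]
      by (intro LIMSEQ_le_const2[OF U.limit_kernel_LIMSEQ[OF \<open>t \<ge> 0\<close>]]) blast
  qed
  then show ?thesis
    using assms by (intro antisym)
qed

text \<open>A ball lies in the set of endpoints of walks of length at most \<open>r\<close> from
  \<open>x0\<close>, which is finite by induction on the length.\<close>

lemma graph_ball_exhaustion:
  assumes "simple_graph V E" "locally_finite_graph V E" "connected_graph V E" "x0 \<in> V"
  shows "network_exhaustion E V (graph_ball V E x0)"
proof
  show E_sub: "E \<subseteq> V \<times> V" and "sym E"
    using assms(1) by (auto simp: simple_graph_def)
  have fin: "finite (E `` {x})" for x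
  proof (cases "x \<in> V")
    case False
    then have "E `` {x} = {}" using E_sub by auto
    then show ?thesis by simp
  qed (use assms(2) in \<open>simp add: locally_finite_graph_def\<close>)
  then show "finite (E `` {x})" for x .
  \<comment> \<open>Connectedness supplies some walk, so the \<open>LEAST\<close> in
    \<open>graph_dist\<close> is attained.\<close>
  have dist: "(x0, y) \<in> E ^^ graph_dist E x0 y" if "y \<in> V" for y
  proof -
    have "(x0, y) \<in> E\<^sup>*"
      using assms(3,4) that by (auto simp: connected_graph_def)
    then obtain n where "(x0, y) \<in> E ^^ n"
      using rtrancl_imp_relpow by metis
    then show ?thesis
      unfolding graph_dist_def by (rule LeastI)
  qed
  have "finite ((E ^^ n) `` {x0})" for n
  proof (induction n)
    case (Suc n)
    have "(E ^^ Suc n) `` {x0} = (\<Union>y\<in>(E ^^ n) `` {x0}. E `` {y})"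
      by auto
    then show ?case
      using Suc fin by simp
  qed simp
  then have "finite (\<Union>n\<in>{..r}. (E ^^ n) `` {x0})" for r
    by simp
  moreover have "graph_ball V E x0 r \<subseteq> (\<Union>n\<in>{..r}. (E ^^ n) `` {x0})" for r
    using dist by (auto simp: graph_ball_def)
  ultimately show "finite (graph_ball V E x0 r)" for r
    using finite_subset by blast
qed (auto simp: graph_ball_def)

theorem theorem2p1p5:
  fixes V :: "'v set" and E :: "'v rel" and x0 :: 'v
    and p :: "real \<Rightarrow> 'v \<Rightarrow> 'v \<Rightarrow> real"
  assumes "simple_graph V E" and "infinite V"
    and "locally_finite_graph V E" and "connected_graph V E"
    and "x0 \<in> V"
    and "p = heat_kernel V E x0"
  shows "(\<forall>t>0. \<forall>x\<in>V. \<forall>y\<in>V. p t x y > 0 \<and> p t x y = p t y x) \<and>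
    (\<forall>x\<in>V. \<forall>y\<in>V. smooth_on_halfline (\<lambda>t. p t x y)) \<and>
    (heat_equation_fst V E {0..} p \<and> heat_equation_snd V E {0..} p) \<and>
    (\<forall>x\<in>V. \<forall>y\<in>V. p 0 x y = (if x = y then 1 else 0)) \<and>
    (\<forall>s\<ge>0. \<forall>t\<ge>0. \<forall>x\<in>V. \<forall>y\<in>V.
           ((\<lambda>z. p s x z * p t z y) has_sum p (s + t) x y) V) \<and>
    (\<forall>t\<ge>0. \<forall>x\<in>V. (\<lambda>y. p t x y) summable_on V \<and> (\<Sum>\<^sub>\<infinity>y\<in>V. p t x y) \<le> 1) \<and>
    (\<forall>W F. graph_exhaustion V E W F \<longrightarrow> (\<forall>t\<ge>0. \<forall>x\<in>V. \<forall>y\<in>V.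
           (\<lambda>i. dirichlet_heat_kernel E (W i) t x y) \<longlonglongrightarrow> p t x y)) \<and>
    (nonneg_heat_solution V E p \<and>
         (\<forall>u. nonneg_heat_solution V E u \<longrightarrow> (\<forall>t\<ge>0. \<forall>x\<in>V. \<forall>y\<in>V. p t x y \<le> u t x y)))"
proof -
  interpret balls: network_exhaustion E V "graph_ball V E x0"
    by (rule graph_ball_exhaustion) (fact assms)+
  have p: "p = balls.limit_kernel"
    unfolding assms(6) by (auto simp: fun_eq_iff heat_kernel_def balls.limit_kernel_def)
  have pos: "0 < p t x y" if "t > 0" "x \<in> V" "y \<in> V" for t x y
    using that assms(4) by (auto simp: p connected_graph_def intro: balls.limit_kernel_pos)
  have commute: "p t x y = p t y x" if "t \<ge> 0" for t x y
    using that by (simp add: p balls.limit_kernel_commute[of t x y])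
  have fst: "heat_equation_fst V E {0..} p"
    unfolding heat_equation_fst_def p using balls.limit_kernel_deriv by fastforce
  have snd: "heat_equation_snd V E {0..} p"
    unfolding heat_equation_snd_def
  proof (intro ballI)
    fix t :: real and x y assume "t \<in> {0..}" "x \<in> V" "y \<in> V"
    then obtain d where d: "((\<lambda>s. p s y x) has_real_derivative d) (at t within {0..})"
      "laplacian E (\<lambda>z. p t z x) y + d = 0"
      using fst unfolding heat_equation_fst_def by blast
    \<comment> \<open>Symmetry is available for nonnegative times only, so the derivative is
      transferred within the half-line.\<close>
    have "((\<lambda>s. p s x y) has_real_derivative d) (at t within {0..})"
      using \<open>t \<in> {0..}\<close> commute[of _ y x]
      by (intro has_field_derivative_transform_within[OF d(1) zero_less_one]) auto
    moreover have "laplacian E (\<lambda>z. p t x z) y + d = 0"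
      using d(2) \<open>t \<in> {0..}\<close> commute[of t x] by simp
    ultimately show "\<exists>d. ((\<lambda>s. p s x y) has_real_derivative d) (at t within {0..}) \<and>
        laplacian E (\<lambda>z. p t x z) y + d = 0"
      by blast
  qed
  have init: "p 0 x y = (if x = y then 1 else 0)" if "x \<in> V" for x y
    using that by (simp add: p balls.limit_kernel_0)
  have exhaustion: "(\<lambda>i. dirichlet_heat_kernel E (W i) t x y) \<longlonglongrightarrow> p t x y"
    if W: "graph_exhaustion V E W F" and "t \<ge> 0" for W F t x y
  proof -
    interpret W: network_exhaustion E V W
      using W balls.E_subset by unfold_locales (auto simp: graph_exhaustion_def)
    show ?thesis
      using W.limit_kernel_LIMSEQ[OF \<open>t \<ge> 0\<close>] p
        limit_kernel_unique[OF balls.network_exhaustion_axioms W.network_exhaustion_axioms \<open>t \<ge> 0\<close>]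
      by simp
  qed
  have solution: "nonneg_heat_solution V E p"
    unfolding nonneg_heat_solution_def
  proof (intro conjI ballI allI impI disjI1)
    show "0 \<le> p t x y" if "t \<ge> 0" for t x y
      using that by (simp add: p balls.limit_kernel_nonneg)
    fix x y assume "x \<in> V" "y \<in> V"
    show "continuous_on {0..} (\<lambda>t. p t x y)"
      unfolding p by (rule balls.limit_kernel_continuous) fact
    have "continuous_on {0<..} (\<lambda>t. - laplacian E (\<lambda>z. p t z y) x)"
      unfolding p using \<open>x \<in> V\<close>
      by (intro continuous_on_minus continuous_on_laplacian
          continuous_on_subset[OF balls.limit_kernel_continuous] balls.neighbor_in_V[OF \<open>x \<in> V\<close>]) auto
    then show "(\<lambda>t. p t x y) C1_differentiable_on {0<..}"
      unfolding C1_differentiable_on_def p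
      using balls.limit_kernel_deriv_at[OF \<open>x \<in> V\<close>]
      by (intro exI[of _ "\<lambda>t. - laplacian E (\<lambda>z. balls.limit_kernel t z y) x"])
        (simp add: has_real_derivative_iff_has_vector_derivative)
  next
    show "heat_equation_fst V E {0<..} p"
      unfolding heat_equation_fst_def p
    proof (intro ballI)
      fix t :: real and x y assume "t \<in> {0<..}" "x \<in> V"
      then show "\<exists>d. ((\<lambda>s. balls.limit_kernel s x y) has_real_derivative d) (at t within {0<..}) \<and>
          laplacian E (\<lambda>z. balls.limit_kernel t z y) x + d = 0"
        using balls.limit_kernel_deriv_at[of x t y, THEN has_field_derivative_at_within] by fastforce
    qed
    show "initial_delta V p"
      using init by (simp add: initial_delta_def)
  qed
  have minimal: "p t x y \<le> u t x y"
    if u: "nonneg_heat_solution V E u" and "t \<ge> 0" "x \<in> V" "y \<in> V" for u t x y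
  proof -
    have nonneg: "0 \<le> u t x y" if "t \<ge> 0" "x \<in> V" "y \<in> V" for t x y
      using u that by (simp add: nonneg_heat_solution_def)
    have cont: "continuous_on {0..} (\<lambda>t. u t x y)" if "x \<in> V" "y \<in> V" for x y
      using u that by (simp add: nonneg_heat_solution_def)
    have init_u: "u 0 x y = (if x = y then 1 else 0)" if "x \<in> V" "y \<in> V" for x y
      using u that by (simp add: nonneg_heat_solution_def initial_delta_def)
    have at: "at t within {0<..} = at t" if "t > 0" for t :: real
      using that by (intro at_within_open) auto
    consider "heat_equation_fst V E {0<..} u" | "heat_equation_snd V E {0<..} u"
      using u unfolding nonneg_heat_solution_def by blast
    then show ?thesis
    proof cases
      case 1
      have heat: "\<exists>d. ((\<lambda>s. u s x y) has_real_derivative d) (at t) \<and> laplacian E (\<lambda>z. u t z y) x + d = 0"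
        if "t > 0" "x \<in> V" for t x
        using 1 that \<open>y \<in> V\<close> at[OF \<open>t > 0\<close>] unfolding heat_equation_fst_def
        by (metis greaterThan_iff)
      show ?thesis
        unfolding p
        by (rule balls.limit_kernel_minimal[where w="\<lambda>t x. u t x y"])
          (use cont heat init_u nonneg that in simp_all)
    next
      case 2
      have heat: "\<exists>d. ((\<lambda>s. u s x y) has_real_derivative d) (at t) \<and> laplacian E (\<lambda>z. u t x z) y + d = 0"
        if "t > 0" "y \<in> V" for t y
        using 2 that \<open>x \<in> V\<close> at[OF \<open>t > 0\<close>] unfolding heat_equation_snd_def
        by (metis greaterThan_iff)
      \<comment> \<open>With \<open>x\<close> fixed, \<open>u t x y\<close> as a function of
        \<open>y\<close> competes against the kernel with its arguments exchanged; symmetry of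
        \<open>p\<close> then restores their order.\<close>
      have "p t y x \<le> u t x y"
        unfolding p
        by (rule balls.limit_kernel_minimal[where w="\<lambda>t y. u t x y"])
          (use cont heat init_u nonneg that in auto)
      then show ?thesis
        using commute[OF \<open>t \<ge> 0\<close>, of x y] by simp
    qed
  qed
  have semigroup: "((\<lambda>z. p s x z * p t z y) has_sum p (s + t) x y) V" if "s \<ge> 0" "t \<ge> 0" for s t x y
    unfolding p by (rule balls.limit_kernel_semigroup) fact+
  have summable: "(\<lambda>y. p t x y) summable_on V" "(\<Sum>\<^sub>\<infinity>y\<in>V. p t x y) \<le> 1" if "t \<ge> 0" for t x
    unfolding p by (rule balls.limit_kernel_summable, fact)+
  have smooth: "smooth_on_halfline (\<lambda>t. p t x y)" if "x \<in> V" for x y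
    unfolding p by (rule balls.limit_kernel_smooth) fact
  show ?thesis
    by (intro conjI allI ballI impI fst snd solution)
      (assumption | rule pos init semigroup summable smooth exhaustion minimal commute less_imp_le)+
qed

end
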